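(* Suppose there is an integer $k$ such that $\mathrm{PCSP}(\mathbf K_k,\mathbf K_c)$ is NP-hard for all integers $c\ge k$. Then $\mathrm{PCSP}(\mathbf K_3,\mathbf K_c)$ is NP-hard for all integers $c\ge 3$.
   Context: $\mathbf K_n$ is the complete loopless undirected graph on $n$ vertices. A homomorphism $\mathbf H\to\mathbf G$ is a vertex map sending edges to edges. For graphs $\mathbf H\to\mathbf G$, $\mathrm{PCSP}(\mathbf H,\mathbf G)$ is the promise decision problem: given a finite graph $\mathbf I$ such that either $\mathbf I\to\mathbf H$ or $\mathbf I\not\to\mathbf G$, output YES in the former case and NO in the latter. (Thus $\mathrm{PCSP}(\mathbf K_k,\mathbf K_c)$ is the problem of distinguishing $k$-colourable graphs from graphs that are not $c$-colourable.) *)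

theory Defs
  imports
    "Graph_Theory.Kuratowski"
    "HOL-Computational_Algebra.Polynomial"
begin

section \<open>Polynomial time on multi-tape Turing machines\<close>

text \<open>
  Machines are deterministic with any fixed number of two-way infinite tapes. States and tape
  symbols are the numbers below a bound, so that machines can be quantified over inside a formula.
  Symbol 0 is the blank, and 1, 2 represent the bits.
\<close>

datatype head_move = Move_Left | Stay | Move_Right

record tm =
  tapes :: nat
  symbols :: nat
  states :: nat
  start :: nat
  halt :: nat
  trans :: "nat \<Rightarrow> nat list \<Rightarrow> nat \<times> (nat \<times> head_move) list"

definition wf_tm :: "tm \<Rightarrow> bool" where
  "wf_tm M \<longleftrightarrow>
     0 < tapes M \<and> 3 \<le> symbols M \<and> start M < states M \<and> halt M < states M \<and>
     (\<forall>q ss. q < states M \<and> length ss = tapes M \<and> set ss \<subseteq> {..<symbols M} \<longrightarrow>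
       (case trans M q ss of (q', acts) \<Rightarrow>
          q' < states M \<and> length acts = tapes M \<and> fst ` set acts \<subseteq> {..<symbols M}))"

text \<open>Tape contents are indexed relative to the head, which always scans cell 0.\<close>

type_synonym tape = "int \<Rightarrow> nat"

fun move_head :: "head_move \<Rightarrow> tape \<Rightarrow> tape" where
  "move_head Move_Left t = (\<lambda>i. t (i - 1))"
| "move_head Stay t = t"
| "move_head Move_Right t = (\<lambda>i. t (i + 1))"

type_synonym config = "nat \<times> tape list"

definition tm_step :: "tm \<Rightarrow> config \<Rightarrow> config" where
  "tm_step M = (\<lambda>(q, ts).
     if q = halt M then (q, ts)
     else case trans M q (map (\<lambda>t. t 0) ts) of (q', acts) \<Rightarrow>
       (q', map2 (\<lambda>(s, m) t. move_head m (t(0 := s))) acts ts))"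

definition string_tape :: "bool list \<Rightarrow> tape" where
  "string_tape w = (\<lambda>i. if 0 \<le> i \<and> i < int (length w) then (if w ! nat i then 2 else 1) else 0)"

definition init_config :: "tm \<Rightarrow> bool list list \<Rightarrow> config" where
  "init_config M xs = (start M, map string_tape (xs @ replicate (tapes M - length xs) []))"

text \<open>
  The output is what is left on the first tape, with the head on its first symbol. Halted
  configurations are fixed by \<^const>\<open>tm_step\<close>, so this says that \<open>M\<close> halts after at most \<open>t\<close> steps.
\<close>

definition tm_computes_within :: "tm \<Rightarrow> bool list list \<Rightarrow> bool list \<Rightarrow> nat \<Rightarrow> bool" where
  "tm_computes_within M xs y t \<longleftrightarrow>
     (case (tm_step M ^^ t) (init_config M xs) of (q, ts) \<Rightarrow>
        q = halt M \<and> ts ! 0 = string_tape y)"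

definition polytime_computable :: "nat \<Rightarrow> (bool list list \<Rightarrow> bool list) \<Rightarrow> bool" where
  "polytime_computable n f \<longleftrightarrow>
     (\<exists>M (p :: nat poly). wf_tm M \<and> n \<le> tapes M \<and>
        (\<forall>xs. length xs = n \<longrightarrow>
           tm_computes_within M xs (f xs) (poly p (sum_list (map length xs)))))"

section \<open>NP and NP-hardness of promise problems\<close>

definition NP :: "bool list set set" where
  "NP = {L. \<exists>V (p :: nat poly). polytime_computable 2 V \<and>
     (\<forall>x. x \<in> L \<longleftrightarrow> (\<exists>w. length w \<le> poly p (length x) \<and> V [x, w] = [True]))}"

text \<open>A promise problem is the pair of its YES-instances and its NO-instances.\<close>

type_synonym promise_problem = "bool list set \<times> bool list set"

definition NP_hard :: "promise_problem \<Rightarrow> bool" where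
  "NP_hard P \<longleftrightarrow>
     (\<forall>L\<in>NP. \<exists>f. polytime_computable 1 f \<and>
        (\<forall>x. (x \<in> L \<longrightarrow> f [x] \<in> fst P) \<and> (x \<notin> L \<longrightarrow> f [x] \<in> snd P)))"

section \<open>Promise constraint satisfaction for graphs\<close>

text \<open>
  Undirected graphs are symmetric digraphs; \<^locale>\<open>pair_pseudo_graph\<close> is the library's notion of a
  finite one, with loops permitted.
\<close>

definition graph_hom :: "('a \<Rightarrow> 'b) \<Rightarrow> 'a pair_pre_digraph \<Rightarrow> 'b pair_pre_digraph \<Rightarrow> bool" where
  "graph_hom f H G \<longleftrightarrow>
     f ` pverts H \<subseteq> pverts G \<and> (\<forall>(u, v) \<in> parcs H. (f u, f v) \<in> parcs G)"

definition hom_to :: "'a pair_pre_digraph \<Rightarrow> 'b pair_pre_digraph \<Rightarrow> bool" where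
  "hom_to H G \<longleftrightarrow> (\<exists>f. graph_hom f H G)"

definition complete_graph :: "nat \<Rightarrow> nat pair_pre_digraph" where
  "complete_graph n = \<lparr>pverts = {..<n}, parcs = {(u, v). u < n \<and> v < n \<and> u \<noteq> v}\<rparr>"

lemma complete_graph_complete: "complete_digraph n (with_proj (complete_graph n))"
  unfolding complete_digraph_pair_def
  by (auto simp: complete_graph_def)

text \<open>Inputs are graphs on an initial segment of the naturals, which covers every finite graph up to
  isomorphism.\<close>

definition input_graph :: "nat pair_pre_digraph \<Rightarrow> bool" where
  "input_graph I \<longleftrightarrow> pair_pseudo_graph I \<and> (\<exists>n. pverts I = {..<n})"

text \<open>The number of vertices in unary, a separator, and the adjacency matrix row by row.\<close>

definition encode_graph :: "nat pair_pre_digraph \<Rightarrow> bool list" where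
  "encode_graph I = (let n = card (pverts I) in
     replicate n True @ [False] @ map (\<lambda>e. e \<in> parcs I) (List.product [0..<n] [0..<n]))"

definition PCSP :: "'a pair_pre_digraph \<Rightarrow> 'b pair_pre_digraph \<Rightarrow> promise_problem" where
  "PCSP H G =
     ({encode_graph I | I. input_graph I \<and> hom_to I H},
      {encode_graph I | I. input_graph I \<and> \<not> hom_to I G})"

lemma encode_graph_inj: "inj_on encode_graph (Collect input_graph)"
proof (rule inj_onI)
  fix I J assume "I \<in> Collect input_graph" "J \<in> Collect input_graph"
    and eq: "encode_graph I = encode_graph J"
  then obtain m n where I: "pair_pseudo_graph I" "pverts I = {..<m}"
    and J: "pair_pseudo_graph J" "pverts J = {..<n}"
    by (auto simp: input_graph_def)
  have len: "length (takeWhile id (encode_graph K)) = card (pverts K)" for K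
    by (simp add: encode_graph_def Let_def takeWhile_append)
  have "m = n"
    using len[of I] len[of J] eq I(2) J(2) by simp
  have sub: "parcs K \<subseteq> pverts K \<times> pverts K" if "pair_pseudo_graph K" for K :: "nat pair_pre_digraph"
  proof -
    interpret pair_pseudo_graph K by fact
    show ?thesis using in_arcsD1 in_arcsD2 by auto
  qed
  have "\<forall>e\<in>set (List.product [0..<n] [0..<n]). e \<in> parcs I \<longleftrightarrow> e \<in> parcs J"
    using eq I(2) J(2) unfolding \<open>m = n\<close> encode_graph_def Let_def by simp
  then have mem: "e \<in> parcs I \<longleftrightarrow> e \<in> parcs J" if "e \<in> {..<n} \<times> {..<n}" for e
    using that by auto
  have "parcs I = parcs J"
    using mem sub[OF I(1)] sub[OF J(1)] unfolding I(2) J(2) \<open>m = n\<close> by blast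
  then show "I = J"
    using \<open>m = n\<close> I(2) J(2) by simp
qed

end

theory Submission
  imports Defs
begin

text \<open>
  Let \<open>\<delta> D\<close> be the arc digraph of \<open>D\<close>: its vertices are the arcs of \<open>D\<close>, with an arc from
  \<open>(u, v)\<close> to \<open>(v, w)\<close>. If \<open>\<delta> D\<close> is \<open>c\<close>-colourable then \<open>D\<close> is \<open>2 ^ c\<close>-colourable. In the other
  direction, \<open>\<delta> (\<delta> K)\<close> is \<open>m\<close>-colourable for the complete graph \<open>K\<close> on \<open>m + 1\<close> vertices, if
  \<open>m \<ge> 3\<close>. So the symmetrised \<open>\<delta> (\<delta> I)\<close> reduces the problem with parameters \<open>m + 1\<close> and
  \<open>2 ^ 2 ^ c\<close> to the one with parameters \<open>m\<close> and \<open>c\<close>, and iterating brings \<open>k\<close> down to 3. That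
  the reduction takes polynomial time is shown by programming \<open>\<delta>\<close> in a small loop language that
  compiles to multi-tape machines.
\<close>

section \<open>Arc graphs and colourings\<close>

text \<open>A single application of \<delta> cannot bring 4 colours down to 3. If the arc digraph of
  a symmetric graph is 3-coloured, adjacent vertices have incomparable sets of outgoing colours; the
  subsets of a 3-set split into three chains, and naming the chain 3-colours the graph itself. So
  \<delta> of the complete graph on 4 vertices is not 3-colourable. The second application gains the
  missing colour, but only because the first one keeps its orientation: symmetrising in between
  would run into the same obstruction again. Hence \<open>arc_graph\<close> carries the flag
  \<open>symm\<close>, which is False first and True last, where the definition of instances
  requires an undirected graph, and graphs are handled by \<open>digraph_on\<close>, which does not
  demand symmetry. The double exponential loss in \<open>c\<close> costs nothing, since hardness is
  assumed for all large \<open>c\<close> at once.\<close>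

definition digraph_on :: "nat \<Rightarrow> nat pair_pre_digraph \<Rightarrow> bool" where
  "digraph_on n D \<longleftrightarrow> pverts D = {..<n} \<and> parcs D \<subseteq> {..<n} \<times> {..<n}"

text \<open>The arc digraph, with vertex \<open>u * n + v\<close> for the pair \<open>(u, v)\<close>. Pairs that are not arcs remain as
  isolated vertices, which is harmless for colourings and keeps the numbering simple.\<close>

definition arc_graph :: "bool \<Rightarrow> nat pair_pre_digraph \<Rightarrow> nat pair_pre_digraph" where
  "arc_graph symm D = (let n = card (pverts D) in
     \<lparr>pverts = {..<n * n},
      parcs = {(p, q). p < n * n \<and> q < n * n \<and>
        (p div n, p mod n) \<in> parcs D \<and> (q div n, q mod n) \<in> parcs D \<and>
        (q div n = p mod n \<or> symm \<and> q mod n = p div n)}\<rparr>)"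

lemma card_pverts_digraph_on: "digraph_on n D \<Longrightarrow> card (pverts D) = n"
  by (simp add: digraph_on_def)

lemma pair_index:
  fixes u v n :: nat
  assumes "u < n" "v < n"
  shows "u * n + v < n * n" "(u * n + v) div n = u" "(u * n + v) mod n = v"
proof -
  have "Suc u * n \<le> n * n"
    using assms by (intro mult_right_mono) auto
  then show "u * n + v < n * n"
    using assms by simp
qed (use assms in auto)

lemma digraph_on_arc_graph: "digraph_on n D \<Longrightarrow> digraph_on (n * n) (arc_graph symm D)"
  by (auto simp: digraph_on_def arc_graph_def)

lemma parcs_arc_graph_iff:
  assumes "digraph_on n D"
  shows "(p, q) \<in> parcs (arc_graph symm D) \<longleftrightarrow> p < n * n \<and> q < n * n \<and>
    (p div n, p mod n) \<in> parcs D \<and> (q div n, q mod n) \<in> parcs D \<and>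
    (q div n = p mod n \<or> symm \<and> q mod n = p div n)"
  using card_pverts_digraph_on[OF assms] by (simp add: arc_graph_def)

lemma digraph_on_input_graph:
  assumes "input_graph I"
  obtains n where "digraph_on n I"
proof -
  from assms obtain n where "pair_pseudo_graph I" and n: "pverts I = {..<n}"
    by (auto simp: input_graph_def)
  then interpret pair_pseudo_graph I by simp
  have "digraph_on n I"
    using in_arcsD1 in_arcsD2 n by (auto simp: digraph_on_def)
  then show thesis by (rule that)
qed

lemma input_graph_arc_graph:
  assumes "digraph_on n D"
  shows "input_graph (arc_graph True D)"
proof -
  let ?A = "arc_graph True D"
  have A: "digraph_on (n * n) ?A"
    using assms by (rule digraph_on_arc_graph)
  then have "finite (parcs ?A)"
    by (auto simp: digraph_on_def intro: finite_subset[OF _ finite_cartesian_product])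
  moreover have "(q, p) \<in> parcs ?A" if "(p, q) \<in> parcs ?A" for p q
    using that by (auto simp: parcs_arc_graph_iff[OF assms])
  then have "symmetric ?A"
    by (auto simp: symmetric_def sym_def)
  ultimately have "pair_pseudo_graph ?A"
    using A by unfold_locales (auto simp: digraph_on_def)
  then show ?thesis
    using A by (auto simp: input_graph_def digraph_on_def)
qed

text \<open>A vertex is coloured by the set of colours of its outgoing arcs: the colour of an arc
  \<open>(u, v)\<close> cannot occur on an arc leaving \<open>v\<close>.\<close>

lemma hom_to_complete_of_arc_graph:
  assumes D: "digraph_on n D" and hom: "hom_to (arc_graph symm D) (complete_graph c)"
  shows "hom_to D (complete_graph (2 ^ c))"
proof -
  from hom obtain f where f: "graph_hom f (arc_graph symm D) (complete_graph c)"
    by (auto simp: hom_to_def)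
  define A where "A u = {f (u * n + v) |v. (u, v) \<in> parcs D}" for u
  \<comment> \<open>A numbering of the sets of colours; their count is the origin of
    \<open>2 ^ c\<close>.\<close>
  obtain h where h: "bij_betw h (Pow {..<c}) {0..<card (Pow {..<c})}"
    using ex_bij_betw_finite_nat[of "Pow {..<c}"] by auto
  have less: "u < n \<and> v < n" if "(u, v) \<in> parcs D" for u v
    using D that by (auto simp: digraph_on_def)
  have sub: "A u \<subseteq> {..<c}" for u
  proof
    fix x assume "x \<in> A u"
    then obtain v where v: "(u, v) \<in> parcs D" "x = f (u * n + v)"
      by (auto simp: A_def)
    then have "u * n + v \<in> pverts (arc_graph symm D)"
      using less[OF v(1)] digraph_on_arc_graph[OF D] by (simp add: digraph_on_def pair_index)
    then show "x \<in> {..<c}"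
      using f v(2) by (auto simp: graph_hom_def complete_graph_def)
  qed
  have ne: "A u \<noteq> A v" if uv: "(u, v) \<in> parcs D" for u v
  proof
    assume "A u = A v"
    moreover have "f (u * n + v) \<in> A u"
      using uv by (auto simp: A_def)
    ultimately obtain w where w: "(v, w) \<in> parcs D" "f (u * n + v) = f (v * n + w)"
      by (auto simp: A_def)
    \<comment> \<open>This arc is present for either value of \<open>symm\<close>, so one lemma
      serves both applications.\<close>
    have "(u * n + v, v * n + w) \<in> parcs (arc_graph symm D)"
      using less[OF uv] less[OF w(1)] uv w(1)
      by (simp add: parcs_arc_graph_iff[OF D] pair_index)
    then show False
      using f w(2) by (auto simp: graph_hom_def complete_graph_def)
  qed
  have hlt: "h (A u) < 2 ^ c" for u
    using bij_betwE[OF h] sub[of u] by (auto simp: card_Pow)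
  moreover have "h (A u) \<noteq> h (A v)" if "(u, v) \<in> parcs D" for u v
    using bij_betw_imp_inj_on[OF h] sub[of u] sub[of v] ne[OF that] by (auto dest: inj_onD)
  ultimately have "graph_hom (\<lambda>u. h (A u)) D (complete_graph (2 ^ c))"
    by (auto simp: graph_hom_def complete_graph_def)
  then show ?thesis
    by (auto simp: hom_to_def)
qed

text \<open>This colours the walks \<open>a b c\<close> in the complete graph on \<open>m + 1\<close> vertices with only \<open>m\<close> colours:
  the middle vertex is the colour unless it is the surplus vertex \<open>m\<close>.\<close>

definition walk_colour :: "nat \<Rightarrow> nat \<Rightarrow> nat \<Rightarrow> nat \<Rightarrow> nat" where
  "walk_colour m a b c = (if b < m then b else (SOME x. x < m \<and> x \<noteq> a \<and> x \<noteq> c))"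

text \<open>The two values \<open>a\<close> and \<open>c\<close> block at most two of the colours 0,
  1, 2. This is where \<open>3 \<le> m\<close> enters, and so why the descent ends at 3.\<close>

lemma walk_colour:
  assumes "3 \<le> m"
  shows "walk_colour m a b c < m"
    and "\<not> b < m \<Longrightarrow> walk_colour m a b c \<noteq> a \<and> walk_colour m a b c \<noteq> c"
proof -
  have "\<exists>x\<in>{0, 1, 2}. x \<noteq> a \<and> x \<noteq> c"
    by auto
  then obtain x where "x \<in> {0, 1, 2}" "x \<noteq> a" "x \<noteq> c"
    by blast
  then have "\<exists>x. x < m \<and> x \<noteq> a \<and> x \<noteq> c"
    using assms by (intro exI[of _ x]) auto
  then have "(SOME x. x < m \<and> x \<noteq> a \<and> x \<noteq> c) < m \<and> (SOME x. x < m \<and> x \<noteq> a \<and> x \<noteq> c) \<noteq> a \<and>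
      (SOME x. x < m \<and> x \<noteq> a \<and> x \<noteq> c) \<noteq> c"
    by (rule someI_ex)
  then show "walk_colour m a b c < m"
    and "\<not> b < m \<Longrightarrow> walk_colour m a b c \<noteq> a \<and> walk_colour m a b c \<noteq> c"
    by (auto simp: walk_colour_def)
qed

text \<open>The walks \<open>a b c\<close> and \<open>b c d\<close> overlap in
  \<open>b \<noteq> c\<close>, so at most one of their middle vertices is surplus. If neither is,
  the colours are \<open>b\<close> and \<open>c\<close>; if one is, its walk was coloured so as to
  avoid the other middle vertex, which is the colour of the other walk.\<close>

lemma walk_colour_proper:
  assumes "3 \<le> m" "b < Suc m" "c < Suc m" "b \<noteq> c"
  shows "walk_colour m a b c \<noteq> walk_colour m b c d"
proof -
  consider "b < m" "c < m" | "\<not> b < m" "c < m" | "b < m" "\<not> c < m"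
    using assms by linarith
  then show ?thesis
  proof cases
    case 1
    then show ?thesis
      using assms by (simp add: walk_colour_def)
  next
    case 2
    then show ?thesis
      using walk_colour(2)[OF assms(1), of b a c] by (simp add: walk_colour_def[of m b c d])
  next
    case 3
    then show ?thesis
      using walk_colour(2)[OF assms(1), of c b d] by (simp add: walk_colour_def[of m a b c])
  qed
qed

lemma hom_to_complete_arc_graph_arc_graph:
  assumes D: "digraph_on n D" and m: "3 \<le> m" and hom: "hom_to D (complete_graph (Suc m))"
  shows "hom_to (arc_graph True (arc_graph False D)) (complete_graph m)"
proof -
  from hom obtain f where f: "graph_hom f D (complete_graph (Suc m))"
    by (auto simp: hom_to_def)
  let ?B = "arc_graph False D"
  let ?N = "n * n"
  \<comment> \<open>A vertex \<open>p\<close> of the double arc graph codes a pair of arcs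
    \<open>(a, b)\<close> and \<open>(b, c)\<close> of \<open>D\<close>; the three arguments decode
    \<open>a\<close>, \<open>b\<close>, \<open>c\<close>. Numbers that code no walk also receive a
    colour below \<open>m\<close>, as the isolated vertices need one.\<close>
  define col where
    "col p = walk_colour m (f (p div ?N div n)) (f (p div ?N mod n)) (f (p mod ?N mod n))" for p
  have B: "digraph_on ?N ?B"
    using D by (rule digraph_on_arc_graph)
  have arc: "f u < Suc m \<and> f v < Suc m \<and> f u \<noteq> f v" if "(u, v) \<in> parcs D" for u v
    using f that by (auto simp: graph_hom_def complete_graph_def)
  have consec: "col p \<noteq> col q"
    if p: "(p div ?N, p mod ?N) \<in> parcs ?B" and q: "(q div ?N, q mod ?N) \<in> parcs ?B"
      and eq: "q div ?N = p mod ?N" for p q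
  proof -
    have p': "(p mod ?N) div n = p div ?N mod n"
      "(p mod ?N div n, p mod ?N mod n) \<in> parcs D"
      using p by (auto simp: parcs_arc_graph_iff[OF D])
    show ?thesis
      using walk_colour_proper[OF m] arc[OF p'(2)] unfolding col_def eq by (simp add: p'(1))
  qed
  have "graph_hom col (arc_graph True ?B) (complete_graph m)"
    unfolding graph_hom_def
  proof (intro conjI ballI, goal_cases)
    case 1
    then show ?case
      using walk_colour(1)[OF m] by (auto simp: complete_graph_def col_def)
  next
    case (2 e)
    obtain p q where e: "e = (p, q)"
      by force
    \<comment> \<open>Symmetrising only adds reversed arcs, so one of the two orders is
      consecutive.\<close>
    have "col p \<noteq> col q"
      using 2 consec[of p q] consec[of q p] unfolding e parcs_arc_graph_iff[OF B] by metis
    then show ?case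
      using walk_colour(1)[OF m] by (simp add: e complete_graph_def col_def)
  qed
  then show ?thesis
    by (auto simp: hom_to_def)
qed

section \<open>The adjacency matrix of the arc graph as four nested loops\<close>

lemma concat_map_blocks:
  "concat (map (\<lambda>u. map (\<lambda>v. g (u * n + v)) [0..<n]) [0..<m]) = map g [0..<m * n]"
proof (induction m)
  case (Suc m)
  have "map g [m * n..<m * n + n] = map (\<lambda>v. g (m * n + v)) [0..<n]"
    by (rule nth_equalityI) auto
  then show ?case
    using Suc upt_add_eq_append[of 0 "m * n" n] by (simp add: add.commute)
qed simp

lemma concat_concat: "concat (concat xss) = concat (map concat xss)"
  by (induction xss) auto

lemma concat_map_concat_blocks:
  "concat (map (\<lambda>u. concat (map (\<lambda>v. g (u * n + v)) [0..<n])) [0..<m]) = concat (map g [0..<m * n])"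
proof -
  have "concat (map g [0..<m * n]) =
      concat (concat (map (\<lambda>u. map (\<lambda>v. g (u * n + v)) [0..<n]) [0..<m]))"
    by (simp only: concat_map_blocks)
  also have "\<dots> = concat (map (\<lambda>u. concat (map (\<lambda>v. g (u * n + v)) [0..<n])) [0..<m])"
    by (simp add: concat_concat comp_def)
  finally show ?thesis ..
qed

text \<open>Separate loops for \<open>u\<close>, \<open>v\<close>, \<open>u'\<close>,
  \<open>v'\<close> replace the division and remainder in \<open>arc_graph\<close>, so that a
  machine with unary counters can emit the bits in this order.\<close>

definition arc_matrix :: "bool \<Rightarrow> nat \<Rightarrow> bool list \<Rightarrow> bool list" where
  "arc_matrix symm n bs = concat (map (\<lambda>u. concat (map (\<lambda>v. concat (map (\<lambda>u'. map (\<lambda>v'.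
     bs ! (u * n + v) \<and> bs ! (u' * n + v') \<and> (u' = v \<or> symm \<and> v' = u))
     [0..<n]) [0..<n])) [0..<n])) [0..<n])"

definition adj_matrix :: "nat pair_pre_digraph \<Rightarrow> bool list" where
  "adj_matrix D = (let n = card (pverts D) in map (\<lambda>e. e \<in> parcs D) (List.product [0..<n] [0..<n]))"

lemma encode_graph_adj_matrix:
  "digraph_on n D \<Longrightarrow> encode_graph D = replicate n True @ False # adj_matrix D"
  by (simp add: encode_graph_def adj_matrix_def card_pverts_digraph_on)

lemma adj_matrix_concat:
  "digraph_on n D \<Longrightarrow>
    adj_matrix D = concat (map (\<lambda>p. map (\<lambda>q. (p, q) \<in> parcs D) [0..<n]) [0..<n])"
  by (simp add: adj_matrix_def card_pverts_digraph_on product_concat_map map_concat comp_def)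

lemma length_adj_matrix: "digraph_on n D \<Longrightarrow> length (adj_matrix D) = n * n"
  by (simp add: adj_matrix_def card_pverts_digraph_on)

lemma nth_adj_matrix:
  assumes "digraph_on n D" "u < n" "v < n"
  shows "adj_matrix D ! (u * n + v) \<longleftrightarrow> (u, v) \<in> parcs D"
proof -
  have "adj_matrix D = map (\<lambda>p. (p div n, p mod n) \<in> parcs D) [0..<n * n]"
    unfolding concat_map_blocks[symmetric] adj_matrix_concat[OF assms(1)]
    by (rule arg_cong[where f = concat], rule map_cong) auto
  then show ?thesis
    using assms(2,3) by (simp add: pair_index)
qed

text \<open>Column indices below \<open>n * n\<close> are split into pairs by
  \<open>concat_map_blocks\<close>, then row indices by
  \<open>concat_map_concat_blocks\<close>.\<close>

lemma adj_matrix_arc_graph: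
  assumes D: "digraph_on n D"
  shows "adj_matrix (arc_graph symm D) = arc_matrix symm n (adj_matrix D)"
proof -
  have "adj_matrix (arc_graph symm D) = concat (map (\<lambda>p. concat (map (\<lambda>u'. map (\<lambda>v'.
      (p, u' * n + v') \<in> parcs (arc_graph symm D)) [0..<n]) [0..<n])) [0..<n * n])"
    unfolding adj_matrix_concat[OF digraph_on_arc_graph[OF D]]
    by (intro arg_cong[where f = concat] map_cong refl concat_map_blocks[symmetric])
  also have "\<dots> =
      concat (map (\<lambda>u. concat (map (\<lambda>v. concat (map (\<lambda>u'. map (\<lambda>v'.
        (u * n + v, u' * n + v') \<in> parcs (arc_graph symm D)) [0..<n]) [0..<n])) [0..<n])) [0..<n])"
    by (rule concat_map_concat_blocks[symmetric])
  also have "\<dots> = arc_matrix symm n (adj_matrix D)"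
    unfolding arc_matrix_def
    by (intro arg_cong[where f = concat] map_cong refl)
      (simp add: parcs_arc_graph_iff[OF D] nth_adj_matrix[OF D] pair_index)
  finally show ?thesis .
qed

section \<open>Composition of Turing machines\<close>

definition wf_config :: "tm \<Rightarrow> config \<Rightarrow> bool" where
  "wf_config M c \<longleftrightarrow> fst c < states M \<and> length (snd c) = tapes M \<and>
     (\<forall>t\<in>set (snd c). \<forall>i. t i < symbols M)"

lemma move_head_range: "\<exists>j. move_head m t i = t j"
  by (cases m) auto

lemma wf_tm_trans:
  assumes "wf_tm M" "q < states M" "length ss = tapes M" "set ss \<subseteq> {..<symbols M}"
    and "trans M q ss = (q', acts)"
  shows "q' < states M" "length acts = tapes M" "fst ` set acts \<subseteq> {..<symbols M}"
proof -
  have "case trans M q ss of (q', acts) \<Rightarrow>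
      q' < states M \<and> length acts = tapes M \<and> fst ` set acts \<subseteq> {..<symbols M}"
    using assms(2-4)
    by (intro assms(1)[unfolded wf_tm_def, THEN conjunct2, THEN conjunct2, THEN conjunct2,
          THEN conjunct2, rule_format] conjI)
  then show "q' < states M" "length acts = tapes M" "fst ` set acts \<subseteq> {..<symbols M}"
    by (simp_all add: assms(5))
qed

lemma tm_step_trans:
  "q \<noteq> halt M \<Longrightarrow> trans M q (map (\<lambda>t. t 0) ts) = (q', acts) \<Longrightarrow>
    tm_step M (q, ts) = (q', map2 (\<lambda>(s, m) t. move_head m (t(0 := s))) acts ts)"
  by (simp add: tm_step_def)

lemma wf_config_tm_step:
  assumes M: "wf_tm M" and c: "wf_config M c"
  shows "wf_config M (tm_step M c)"
proof -
  obtain q ts where qts: "c = (q, ts)"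
    by (rule prod.exhaust)
  show ?thesis
  proof (cases "q = halt M")
    case True
    then show ?thesis
      using c by (simp add: qts tm_step_def)
  next
    case False
    let ?ss = "map (\<lambda>t. t 0) ts"
    obtain q' acts where tr: "trans M q ?ss = (q', acts)"
      by (rule prod.exhaust)
    have ts: "q < states M" "length ts = tapes M" "\<forall>t\<in>set ts. \<forall>i. t i < symbols M"
      using c by (auto simp: qts wf_config_def)
    have ss: "length ?ss = tapes M" "set ?ss \<subseteq> {..<symbols M}"
      using ts by auto
    note w = wf_tm_trans[OF M ts(1) ss tr]
    have "move_head m (t(0 := s)) i < symbols M" if "(s, m) \<in> set acts" "t \<in> set ts" for s m t i
      using move_head_range[of m "t(0 := s)" i] w(3) ts(3) that by fastforce
    then have "\<forall>t\<in>set (map2 (\<lambda>(s, m) t. move_head m (t(0 := s))) acts ts). \<forall>i. t i < symbols M"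
      by (clarsimp, meson set_zip_leftD set_zip_rightD)
    then show ?thesis
      using False w(1,2) ts(2) by (simp add: qts wf_config_def tm_step_def tr)
  qed
qed

lemma wf_config_tm_steps:
  "wf_tm M \<Longrightarrow> wf_config M c \<Longrightarrow> wf_config M ((tm_step M ^^ t) c)"
  by (induction t) (auto intro: wf_config_tm_step)

lemma wf_config_init:
  "wf_tm M \<Longrightarrow> length xs \<le> tapes M \<Longrightarrow> wf_config M (init_config M xs)"
  by (auto simp: wf_config_def init_config_def wf_tm_def string_tape_def)

lemma tm_step_halted: "fst c = halt M \<Longrightarrow> tm_step M c = c"
  by (cases c) (simp add: tm_step_def)

lemma tm_steps_halted: "fst c = halt M \<Longrightarrow> (tm_step M ^^ t) c = c"
  by (induction t) (auto simp: tm_step_halted)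

lemma tm_steps_mono:
  assumes "fst ((tm_step M ^^ t) c) = halt M" "t \<le> t'"
  shows "(tm_step M ^^ t') c = (tm_step M ^^ t) c"
proof -
  have "(tm_step M ^^ t') c = (tm_step M ^^ (t' - t)) ((tm_step M ^^ t) c)"
    using assms(2) by (metis comp_apply funpow_add le_add_diff_inverse2)
  then show ?thesis
    using tm_steps_halted[OF assms(1)] by simp
qed

lemma tm_computes_within_mono:
  "tm_computes_within M xs y t \<Longrightarrow> t \<le> t' \<Longrightarrow> tm_computes_within M xs y t'"
  using tm_steps_mono[where M = M and t = t and c = "init_config M xs" and t' = t']
  by (auto simp: tm_computes_within_def split: prod.splits)

section \<open>Bounding the output length by counting nonblank cells\<close>

lemma nonblank_move_head:
  assumes "finite {i. t i \<noteq> 0}"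
  shows "finite {i. move_head m t i \<noteq> 0} \<and> card {i. move_head m t i \<noteq> 0} = card {i. t i \<noteq> 0}"
proof -
  obtain d :: int where d: "move_head m t = (\<lambda>i. t (i + d))"
    by (cases m) (force intro: that[of "-1"] that[of 0] that[of 1])+
  have "bij_betw (\<lambda>i. i + d) {i. t (i + d) \<noteq> 0} {i. t i \<noteq> 0}"
    by (rule bij_betwI[where g = "\<lambda>i. i - d"]) auto
  then show ?thesis
    using assms by (simp add: d bij_betw_finite bij_betw_same_card)
qed

lemma nonblank_write:
  fixes t :: tape
  assumes "finite {i. t i \<noteq> 0}"
  shows "finite {i. (t(0 := s)) i \<noteq> 0} \<and> card {i. (t(0 := s)) i \<noteq> 0} \<le> Suc (card {i. t i \<noteq> 0})"
proof -
  have sub: "{i. (t(0 := s)) i \<noteq> 0} \<subseteq> insert 0 {i. t i \<noteq> 0}"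
    by auto
  then have "card {i. (t(0 := s)) i \<noteq> 0} \<le> card (insert 0 {i. t i \<noteq> 0})"
    using assms by (intro card_mono) auto
  also have "\<dots> \<le> Suc (card {i. t i \<noteq> 0})"
    by (rule card_insert_le_m1) auto
  finally show ?thesis
    using finite_subset[OF sub] assms by simp
qed

text \<open>Cells are numbered relative to the head, so a move translates the tape and preserves the
  number of nonblank cells, while a write adds at most one. Counting thus avoids tracking absolute
  positions.\<close>

lemma nonblank_tm_steps:
  assumes M: "wf_tm M" and c: "wf_config M c" and fin: "finite {i. (snd c ! 0) i \<noteq> 0}"
  shows "finite {i. (snd ((tm_step M ^^ t) c) ! 0) i \<noteq> 0} \<and>
    card {i. (snd ((tm_step M ^^ t) c) ! 0) i \<noteq> 0} \<le> card {i. (snd c ! 0) i \<noteq> 0} + t"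
proof (induction t)
  case 0
  then show ?case
    using fin by simp
next
  case (Suc t)
  obtain q ts where qts: "(tm_step M ^^ t) c = (q, ts)"
    by (rule prod.exhaust)
  have wf: "wf_config M (q, ts)"
    using wf_config_tm_steps[OF M c, of t] qts by simp
  show ?case
  proof (cases "q = halt M")
    case True
    then show ?thesis
      using Suc by (simp add: qts tm_step_halted)
  next
    case False
    let ?ss = "map (\<lambda>t. t 0) ts"
    obtain q' acts where tr: "trans M q ?ss = (q', acts)"
      by (rule prod.exhaust)
    have ts: "q < states M" "length ts = tapes M" "\<forall>t\<in>set ts. \<forall>i. t i < symbols M"
      using wf by (auto simp: wf_config_def)
    have ss: "length ?ss = tapes M" "set ?ss \<subseteq> {..<symbols M}"
      using ts by auto
    obtain s m where sm: "acts ! 0 = (s, m)"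
      by (rule prod.exhaust)
    have step: "tm_step M (q, ts) = (q', map2 (\<lambda>(s, m) t. move_head m (t(0 := s))) acts ts)"
      using False by (simp add: tm_step_def tr)
    have "0 < tapes M"
      using M by (simp add: wf_tm_def)
    then have "snd ((tm_step M ^^ Suc t) c) ! 0 = move_head m ((ts ! 0)(0 := s))"
      using wf_tm_trans(2)[OF M ts(1) ss tr] ts(2) sm by (simp add: qts step)
    moreover note nonblank_write[of "ts ! 0" s] nonblank_move_head[of "(ts ! 0)(0 := s)" m]
    ultimately show ?thesis
      using Suc by (simp add: qts)
  qed
qed

lemma nonblank_string_tape: "{i. string_tape w i \<noteq> 0} = {0..<int (length w)}"
  by (auto simp: string_tape_def)

lemma tm_output_length:
  assumes M: "wf_tm M" and out: "tm_computes_within M [x] y t"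
  shows "length y \<le> length x + t"
proof -
  have "0 < tapes M"
    using M by (simp add: wf_tm_def)
  then have c: "wf_config M (init_config M [x])"
    using M by (intro wf_config_init) auto
  have x: "snd (init_config M [x]) ! 0 = string_tape x"
    by (simp add: init_config_def)
  have y: "snd ((tm_step M ^^ t) (init_config M [x])) ! 0 = string_tape y"
    using out by (auto simp: tm_computes_within_def split: prod.splits)
  show ?thesis
    using nonblank_tm_steps[OF M c, of t] unfolding x y nonblank_string_tape by simp
qed

text \<open>The first tape is shared, so that the output of \<open>M\<close> is already in place as the input of \<open>M'\<close>.
  The guards keep the transition function within bounds on symbols that one of the machines does not
  know.\<close>

definition seq_tm :: "tm \<Rightarrow> tm \<Rightarrow> tm" where
  "seq_tm M M' =
    \<lparr>tapes = tapes M + (tapes M' - 1), symbols = max (symbols M) (symbols M'),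
     states = states M + states M', start = start M, halt = states M + halt M',
     trans = (\<lambda>q ss.
       if q < states M then
         if q \<noteq> halt M \<and> set (take (tapes M) ss) \<subseteq> {..<symbols M} then
           (case trans M q (take (tapes M) ss) of (q', acts) \<Rightarrow>
             (q', acts @ map (\<lambda>s. (s, Stay)) (drop (tapes M) ss)))
         else (states M + start M', map (\<lambda>s. (s, Stay)) ss)
       else
         if set (hd ss # drop (tapes M) ss) \<subseteq> {..<symbols M'} then
           (case trans M' (q - states M) (hd ss # drop (tapes M) ss) of (q', acts) \<Rightarrow>
             (states M + q',
              hd acts # map (\<lambda>s. (s, Stay)) (tl (take (tapes M) ss)) @ tl acts))
         else (0, map (\<lambda>s. (s, Stay)) ss))\<rparr>"

lemma seq_tm_sel:
  "tapes (seq_tm M M') = tapes M + (tapes M' - 1)"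
  "symbols (seq_tm M M') = max (symbols M) (symbols M')"
  "states (seq_tm M M') = states M + states M'"
  "start (seq_tm M M') = start M"
  "halt (seq_tm M M') = states M + halt M'"
  by (simp_all add: seq_tm_def)

lemma wf_seq_tm:
  assumes M: "wf_tm M" and M': "wf_tm M'"
  shows "wf_tm (seq_tm M M')"
proof -
  have pos: "0 < tapes M" "0 < tapes M'" "0 < states M" "start M' < states M'"
    using M M' by (auto simp: wf_tm_def)
  have "q' < states M + states M' \<and> length acts = tapes M + (tapes M' - 1) \<and>
      fst ` set acts \<subseteq> {..<max (symbols M) (symbols M')}"
    if q: "q < states M + states M'" and len: "length ss = tapes M + (tapes M' - 1)"
      and ss: "set ss \<subseteq> {..<max (symbols M) (symbols M')}"
      and tr: "trans (seq_tm M M') q ss = (q', acts)" for q ss q' acts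
  proof -
    have idle: "fst ` set (map (\<lambda>s. (s, Stay)) zs) \<subseteq> {..<max (symbols M) (symbols M')}"
      if "set zs \<subseteq> set ss" for zs
      using ss that by (auto simp: image_image)
    show ?thesis
    proof (cases "q < states M")
      case lt: True
      show ?thesis
      proof (cases "q \<noteq> halt M \<and> set (take (tapes M) ss) \<subseteq> {..<symbols M}")
        case True
        obtain q1 acts1 where tr1: "trans M q (take (tapes M) ss) = (q1, acts1)"
          by (rule prod.exhaust)
        have "length (take (tapes M) ss) = tapes M"
          using len by simp
        note w = wf_tm_trans[OF M lt this _ tr1]
        have "fst ` set acts1 \<subseteq> {..<max (symbols M) (symbols M')}"
          using w(3) True by fastforce
        moreover have "q' = q1" "acts = acts1 @ map (\<lambda>s. (s, Stay)) (drop (tapes M) ss)"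
          using tr tr1 lt True by (simp_all add: seq_tm_def)
        ultimately show ?thesis
          using w(1,2) True idle[OF set_drop_subset[of "tapes M"]] len by (simp add: image_Un)
      next
        case False
        then have "q' = states M + start M'" "acts = map (\<lambda>s. (s, Stay)) ss"
          using tr lt False by (simp_all add: seq_tm_def split: if_splits)
        then show ?thesis
          using pos idle[OF subset_refl] len by auto
      qed
    next
      case ge: False
      show ?thesis
      proof (cases "set (hd ss # drop (tapes M) ss) \<subseteq> {..<symbols M'}")
        case True
        obtain q1 acts1 where tr1: "trans M' (q - states M) (hd ss # drop (tapes M) ss) = (q1, acts1)"
          by (rule prod.exhaust)
        have "q - states M < states M'" "length (hd ss # drop (tapes M) ss) = tapes M'"
          using len pos q ge by auto
        note w = wf_tm_trans[OF M' this True tr1]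
        from w(2) pos(2) obtain z zs where z: "acts1 = z # zs"
          by (cases acts1) auto
        have tl: "set (tl (take (tapes M) ss)) \<subseteq> set ss"
          by (metis drop_Suc drop_0 set_drop_subset set_take_subset subset_trans)
        have "fst ` set acts1 \<subseteq> {..<max (symbols M) (symbols M')}"
          using w(3) by fastforce
        moreover have "q' = states M + q1"
            "acts = z # map (\<lambda>s. (s, Stay)) (tl (take (tapes M) ss)) @ zs"
          using tr tr1 ge True by (simp_all add: seq_tm_def z)
        ultimately show ?thesis
          using w(1,2) idle[OF tl] len pos by (simp add: image_Un z)
      next
        case False
        then have "q' = 0" "acts = map (\<lambda>s. (s, Stay)) ss"
          using tr ge False by (simp_all add: seq_tm_def split: if_splits)
        then show ?thesis
          using pos idle[OF subset_refl] len by auto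
      qed
    qed
  qed
  then have "\<forall>q ss. q < states (seq_tm M M') \<and> length ss = tapes (seq_tm M M') \<and>
      set ss \<subseteq> {..<symbols (seq_tm M M')} \<longrightarrow>
      (case trans (seq_tm M M') q ss of (q', acts) \<Rightarrow>
        q' < states (seq_tm M M') \<and> length acts = tapes (seq_tm M M') \<and>
        fst ` set acts \<subseteq> {..<symbols (seq_tm M M')})"
    unfolding seq_tm_sel by (intro allI impI case_prodI2) blast
  moreover have "halt M' < states M'" "start M < states M" "3 \<le> symbols M"
    using M M' by (auto simp: wf_tm_def)
  ultimately show ?thesis
    using pos unfolding wf_tm_def by (simp add: seq_tm_sel)
qed

lemma map2_idle:
  "length ss = length ts \<Longrightarrow> map (\<lambda>t. t 0) ts = ss \<Longrightarrow>
    map2 (\<lambda>(s, m) t. move_head m (t(0 := s))) (map (\<lambda>s. (s, Stay)) ss) ts = ts"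
  by (rule nth_equalityI) auto

lemma seq_tm_first:
  assumes M: "wf_tm M" and c: "wf_config M (q, ts)" and "q \<noteq> halt M"
    and step: "tm_step M (q, ts) = (q', ts')"
  shows "tm_step (seq_tm M M') (q, ts @ us) = (q', ts' @ us)"
proof -
  let ?ss = "map (\<lambda>t. t 0) ts"
  obtain q1 acts where tr: "trans M q ?ss = (q1, acts)"
    by (rule prod.exhaust)
  have ts: "q < states M" "length ts = tapes M" "set ?ss \<subseteq> {..<symbols M}"
    using c by (auto simp: wf_config_def)
  have "length ?ss = tapes M"
    using ts by simp
  note w = wf_tm_trans[OF M ts(1) this ts(3) tr]
  have "trans (seq_tm M M') q (map (\<lambda>t. t 0) (ts @ us)) =
      (q1, acts @ map (\<lambda>s. (s, Stay)) (map (\<lambda>t. t 0) us))"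
    using ts tr assms(3) by (simp add: seq_tm_def)
  moreover have "q \<noteq> halt (seq_tm M M')"
    using ts(1) by (simp add: seq_tm_sel)
  ultimately have "tm_step (seq_tm M M') (q, ts @ us) = (q1,
      map2 (\<lambda>(s, m) t. move_head m (t(0 := s)))
        (acts @ map (\<lambda>s. (s, Stay)) (map (\<lambda>t. t 0) us)) (ts @ us))"
    by (intro tm_step_trans)
  also have "\<dots> = (q1, map2 (\<lambda>(s, m) t. move_head m (t(0 := s))) acts ts @ us)"
    using map2_idle[of "map (\<lambda>t. t 0) us" us] w(2) ts(2) by simp
  also have "\<dots> = (q', ts' @ us)"
    using step tm_step_trans[OF assms(3) tr] by simp
  finally show ?thesis .
qed

text \<open>The tapes are the shared one \<open>t\<close>, then the work tapes \<open>ts\<close> of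
  \<open>M\<close>, then the private tapes \<open>us\<close> of \<open>M'\<close>. The first machine
  may leave rubbish on \<open>ts\<close>; \<open>M'\<close> never consults it and starts on blank
  tapes of its own.\<close>

lemma seq_tm_second:
  assumes M: "wf_tm M'" and c: "wf_config M' (q, t # us)" and "Suc (length ts) = tapes M"
    and step: "tm_step M' (q, t # us) = (q', t' # us')"
  shows "tm_step (seq_tm M M') (states M + q, t # ts @ us) = (states M + q', t' # ts @ us')"
proof (cases "q = halt M'")
  case True
  then show ?thesis
    using step by (simp add: tm_step_halted seq_tm_sel)
next
  case False
  let ?ss = "map (\<lambda>t. t 0) (t # us)"
  obtain q1 acts where tr: "trans M' q ?ss = (q1, acts)"
    by (rule prod.exhaust)
  have ts: "q < states M'" "length (t # us) = tapes M'" "set ?ss \<subseteq> {..<symbols M'}"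
    using c by (auto simp: wf_config_def)
  have "length ?ss = tapes M'"
    using ts by simp
  note w = wf_tm_trans[OF M ts(1) this ts(3) tr]
  obtain s m zs where z: "acts = (s, m) # zs" "length zs = length us"
    using w(2) ts(2) by (cases acts) auto
  have len: "tapes M = Suc (length ts)"
    using assms(3) by simp
  have "trans (seq_tm M M') (states M + q) (map (\<lambda>t. t 0) (t # ts @ us)) =
      (states M + q1, (s, m) # map (\<lambda>s. (s, Stay)) (map (\<lambda>t. t 0) ts) @ zs)"
    using ts(3) tr by (simp add: seq_tm_def z len)
  moreover have "states M + q \<noteq> halt (seq_tm M M')"
    using False by (simp add: seq_tm_sel)
  ultimately have "tm_step (seq_tm M M') (states M + q, t # ts @ us) = (states M + q1,
      map2 (\<lambda>(s, m) t. move_head m (t(0 := s)))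
        ((s, m) # map (\<lambda>s. (s, Stay)) (map (\<lambda>t. t 0) ts) @ zs) (t # ts @ us))"
    by (intro tm_step_trans)
  also have "\<dots> = (states M + q1, move_head m (t(0 := s)) # ts @
      map2 (\<lambda>(s, m) t. move_head m (t(0 := s))) zs us)"
    using map2_idle[of "map (\<lambda>t. t 0) ts" ts] by simp
  also have "\<dots> = (states M + q', t' # ts @ us')"
    using step tm_step_trans[OF False tr] by (simp add: z)
  finally show ?thesis .
qed

lemma seq_tm_first_steps:
  assumes M: "wf_tm M" and c: "wf_config M (q, ts)"
    and "\<And>i. i < t \<Longrightarrow> fst ((tm_step M ^^ i) (q, ts)) \<noteq> halt M"
    and "(tm_step M ^^ t) (q, ts) = (q', ts')"
  shows "(tm_step (seq_tm M M') ^^ t) (q, ts @ us) = (q', ts' @ us)"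
  using assms(3,4)
proof (induction t arbitrary: q' ts')
  case (Suc t)
  obtain q1 ts1 where s: "(tm_step M ^^ t) (q, ts) = (q1, ts1)"
    by (rule prod.exhaust)
  have "wf_config M (q1, ts1)"
    using wf_config_tm_steps[OF M c, of t] s by simp
  moreover have "q1 \<noteq> halt M"
    using Suc.prems(1)[of t] s by simp
  ultimately show ?case
    using seq_tm_first[OF M] Suc s by simp
qed simp

lemma seq_tm_second_steps:
  assumes M: "wf_tm M'" and c: "wf_config M' (q, u # us)" and len: "Suc (length ts) = tapes M"
  shows "\<exists>q' u' us'. (tm_step M' ^^ t) (q, u # us) = (q', u' # us') \<and>
    (tm_step (seq_tm M M') ^^ t) (states M + q, u # ts @ us) = (states M + q', u' # ts @ us')"
proof (induction t)
  case (Suc t)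
  then obtain q1 u1 us1 where s: "(tm_step M' ^^ t) (q, u # us) = (q1, u1 # us1)"
      "(tm_step (seq_tm M M') ^^ t) (states M + q, u # ts @ us) = (states M + q1, u1 # ts @ us1)"
    by blast
  obtain q2 vs where s2: "tm_step M' (q1, u1 # us1) = (q2, vs)"
    by (rule prod.exhaust)
  have wf: "wf_config M' (q1, u1 # us1)"
    using wf_config_tm_steps[OF M c, of t] s by simp
  have "length vs = tapes M'" "0 < tapes M'"
    using wf_config_tm_step[OF M wf] M by (auto simp: s2 wf_config_def wf_tm_def)
  then obtain u2 us2 where vs: "vs = u2 # us2"
    by (cases vs) auto
  then show ?case
    using seq_tm_second[OF M wf len] s s2 by simp
qed simp

lemma tm_computes_within_seq_tm:
  assumes M: "wf_tm M" "tm_computes_within M [x] y t" and M': "wf_tm M'" "tm_computes_within M' [y] z t'"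
  shows "tm_computes_within (seq_tm M M') [x] z (t + 1 + t')"
proof -
  let ?S = "seq_tm M M'"
  have pos: "0 < tapes M" "0 < tapes M'" "halt M < states M"
    using M(1) M'(1) by (auto simp: wf_tm_def)
  define ts where "ts = map string_tape ([x] @ replicate (tapes M - 1) [])"
  define us where "us = map string_tape (replicate (tapes M' - 1) [])"
  have init: "init_config M [x] = (start M, ts)"
    by (simp add: init_config_def ts_def)
  have init': "init_config M' [y] = (start M', string_tape y # us)"
    by (simp add: init_config_def us_def)
  have "tapes M + (tapes M' - 1) - 1 = (tapes M - 1) + (tapes M' - 1)"
    using pos by simp
  then have initS: "init_config ?S [x] = (start M, ts @ us)"
    by (simp add: init_config_def seq_tm_def ts_def us_def replicate_add)
  have c: "wf_config M (start M, ts)" and c': "wf_config M' (start M', string_tape y # us)"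
    using wf_config_init[of M "[x]"] wf_config_init[of M' "[y]"] M(1) M'(1) pos
    unfolding init init' by auto
  \<comment> \<open>\<open>M\<close> may halt before its bound \<open>t\<close>, and
    \<open>seq_tm\<close> hands over at the first visit to the halting state, so the simulation must
    stop exactly there.\<close>
  define t0 where "t0 = (LEAST i. fst ((tm_step M ^^ i) (start M, ts)) = halt M)"
  have halt: "fst ((tm_step M ^^ t) (start M, ts)) = halt M"
    using M(2) by (auto simp: tm_computes_within_def init split: prod.splits)
  then have t0: "fst ((tm_step M ^^ t0) (start M, ts)) = halt M" "t0 \<le> t"
    unfolding t0_def by (auto intro: LeastI Least_le)
  have nh: "fst ((tm_step M ^^ i) (start M, ts)) \<noteq> halt M" if "i < t0" for i
    using that not_less_Least unfolding t0_def by blast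
  have "snd ((tm_step M ^^ t0) (start M, ts)) ! 0 = string_tape y"
    using M(2) tm_steps_mono[OF t0] by (auto simp: tm_computes_within_def init split: prod.splits)
  moreover have "length (snd ((tm_step M ^^ t0) (start M, ts))) = tapes M"
    using wf_config_tm_steps[OF M(1) c, of t0] by (simp add: wf_config_def)
  ultimately obtain vs where vs: "(tm_step M ^^ t0) (start M, ts) = (halt M, string_tape y # vs)"
      "Suc (length vs) = tapes M"
    using t0(1) pos(1)
    by (cases "(tm_step M ^^ t0) (start M, ts)"; cases "snd ((tm_step M ^^ t0) (start M, ts))") auto
  have "(tm_step ?S ^^ t0) (start M, ts @ us) = (halt M, string_tape y # vs @ us)"
    using seq_tm_first_steps[OF M(1) c nh vs(1)] by simp
  \<comment> \<open>The handover takes one step, the \<open>1\<close> in the time bound.\<close>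
  moreover have "tm_step ?S (halt M, string_tape y # vs @ us) =
      (states M + start M', string_tape y # vs @ us)"
    using pos map2_idle[OF _ refl, of "string_tape y # vs @ us"]
    by (simp add: tm_step_def seq_tm_def comp_def)
  ultimately have s1: "(tm_step ?S ^^ (Suc t0)) (start M, ts @ us) =
      (states M + start M', string_tape y # vs @ us)"
    by simp
  obtain q' u' us' where s2: "(tm_step M' ^^ t') (start M', string_tape y # us) = (q', u' # us')"
      "(tm_step ?S ^^ t') (states M + start M', string_tape y # vs @ us) = (states M + q', u' # vs @ us')"
    using seq_tm_second_steps[OF M'(1) c' vs(2)] by blast
  have "q' = halt M'" "u' = string_tape z"
    using M'(2) s2(1) by (auto simp: tm_computes_within_def init')
  then have "tm_computes_within ?S [x] z (t' + Suc t0)"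
    unfolding tm_computes_within_def initS funpow_add comp_apply s1 s2 by (simp add: seq_tm_def)
  then show ?thesis
    by (rule tm_computes_within_mono) (use t0(2) in simp)
qed

lemma poly_nat_mono: "a \<le> b \<Longrightarrow> poly (p :: nat poly) a \<le> poly p b"
proof (induction p)
  case (pCons c p)
  then show ?case
    by (simp add: mult_le_mono)
qed simp

text \<open>Relative to a set of inputs, because the programs below need only handle valid
  encodings, whereas \<open>polytime_computable\<close> quantifies over all strings.\<close>

definition polytime_on :: "bool list set \<Rightarrow> (bool list \<Rightarrow> bool list) \<Rightarrow> bool" where
  "polytime_on S g \<longleftrightarrow> (\<exists>M (p :: nat poly). wf_tm M \<and>
     (\<forall>x\<in>S. tm_computes_within M [x] (g x) (poly p (length x))))"

lemma polytime_computable_compose: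
  assumes f: "polytime_computable 1 f" and g: "polytime_on S g" and S: "\<And>x. f [x] \<in> S"
  shows "polytime_computable 1 (\<lambda>xs. g (f xs))"
proof -
  obtain M and p :: "nat poly" where M: "wf_tm M"
      "\<And>xs. length xs = 1 \<Longrightarrow> tm_computes_within M xs (f xs) (poly p (sum_list (map length xs)))"
    using f unfolding polytime_computable_def by blast
  obtain M' and p' :: "nat poly" where M': "wf_tm M'"
      "\<And>x. x \<in> S \<Longrightarrow> tm_computes_within M' [x] (g x) (poly p' (length x))"
    using g unfolding polytime_on_def by blast
  \<comment> \<open>The time of \<open>M\<close>, the handover, and the time of \<open>M'\<close> on
    an output of length at most the input length plus the time of \<open>M\<close>.\<close>
  define r where "r = p + 1 + pcompose p' ([:0, 1:] + p)"
  have "tm_computes_within (seq_tm M M') [x] (g (f [x])) (poly r (length x))" for x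
  proof -
    let ?t = "poly p (length x)"
    have 1: "tm_computes_within M [x] (f [x]) ?t"
      using M(2)[of "[x]"] by simp
    have "poly p' (length (f [x])) \<le> poly p' (length x + ?t)"
      using tm_output_length[OF M(1) 1] by (rule poly_nat_mono)
    then have "?t + 1 + poly p' (length (f [x])) \<le> poly r (length x)"
      by (simp add: r_def poly_pcompose)
    then show ?thesis
      using tm_computes_within_seq_tm[OF M(1) 1 M'(1) M'(2)[OF S]] tm_computes_within_mono by blast
  qed
  then have "\<forall>xs. length xs = 1 \<longrightarrow>
      tm_computes_within (seq_tm M M') xs (g (f xs)) (poly r (sum_list (map length xs)))"
    by (auto simp: length_Suc_conv)
  moreover have "1 \<le> tapes (seq_tm M M')"
    using M(1) by (simp add: seq_tm_def wf_tm_def)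
  ultimately show ?thesis
    using wf_seq_tm[OF M(1) M'(1)] unfolding polytime_computable_def by blast
qed

section \<open>Structured programs for Turing machines\<close>

datatype prog =
    Upd nat "(nat \<Rightarrow> nat) \<Rightarrow> nat" head_move
  | Seq prog prog (infixr ";;" 60)
  | While "(nat \<Rightarrow> nat) \<Rightarrow> bool" prog

text \<open>Programs act on families of tapes. The functions in a program are applied to the
  family of scanned symbols, and \<^term>\<open>Upd i f m\<close> writes to tape \<open>i\<close> before moving its head.\<close>

inductive exec :: "prog \<Rightarrow> (nat \<Rightarrow> tape) \<Rightarrow> nat \<Rightarrow> (nat \<Rightarrow> tape) \<Rightarrow> bool" where
  Upd: "exec (Upd i f m) s 1 (s(i := move_head m ((s i)(0 := f (\<lambda>j. s j 0)))))"
| Seq: "exec P s t s' \<Longrightarrow> exec Q s' t' s'' \<Longrightarrow> exec (P ;; Q) s (t + t') s''"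
| While_False: "\<not> c (\<lambda>j. s j 0) \<Longrightarrow> exec (While c P) s 1 s"
| While_True: "c (\<lambda>j. s j 0) \<Longrightarrow> exec P s t s' \<Longrightarrow> exec (While c P) s' t' s'' \<Longrightarrow>
    exec (While c P) s (1 + t + t') s''"

text \<open>The functions in a program see an infinite family of symbols; to be a transition table
  they must depend on the first \<open>K\<close> tapes only, and writes must stay within the three
  symbols.\<close>

primrec wf_prog :: "nat \<Rightarrow> prog \<Rightarrow> bool" where
  "wf_prog K (Upd i f m) \<longleftrightarrow> i < K \<and> (\<forall>r. (\<forall>j<K. r j < 3) \<longrightarrow> f r < 3) \<and>
     (\<forall>r r'. (\<forall>j<K. r j = r' j) \<longrightarrow> f r = f r')"
| "wf_prog K (P ;; Q) \<longleftrightarrow> wf_prog K P \<and> wf_prog K Q"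
| "wf_prog K (While c P) \<longleftrightarrow> wf_prog K P \<and> (\<forall>r r'. (\<forall>j<K. r j = r' j) \<longrightarrow> c r = c r')"

primrec prog_states :: "prog \<Rightarrow> nat" where
  "prog_states (Upd i f m) = 1"
| "prog_states (P ;; Q) = prog_states P + prog_states Q"
| "prog_states (While c P) = Suc (prog_states P)"

text \<open>The program occupies the states from \<open>l\<close> on, starts in \<open>l\<close> and exits to \<open>e\<close>.\<close>

primrec prog_trans :: "prog \<Rightarrow> nat \<Rightarrow> nat \<Rightarrow> nat \<Rightarrow> nat list \<Rightarrow> nat \<times> (nat \<times> head_move) list" where
  "prog_trans (Upd i f m) l e q ss =
     (e, map (\<lambda>j. if j = i then (f ((!) ss), m) else (ss ! j, Stay)) [0..<length ss])"
| "prog_trans (P ;; Q) l e q ss =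
     (if q < l + prog_states P then prog_trans P l (l + prog_states P) q ss
      else prog_trans Q (l + prog_states P) e q ss)"
| "prog_trans (While c P) l e q ss =
     (if q = l then (if c ((!) ss) then Suc l else e, map (\<lambda>s. (s, Stay)) ss)
      else prog_trans P (Suc l) l q ss)"

lemma prog_states_pos: "0 < prog_states P"
  by (induction P) auto

lemma prog_trans_bounds:
  assumes "wf_prog K P" "l \<le> q" "q < l + prog_states P" "length ss = K" "set ss \<subseteq> {..<3}"
    and "prog_trans P l e q ss = (q', acts)"
  shows "(q' = e \<or> l \<le> q' \<and> q' < l + prog_states P) \<and> length acts = K \<and> fst ` set acts \<subseteq> {..<3}"
  using assms
proof (induction P arbitrary: l e q')
  case (Upd i f m)
  have "ss ! j < 3" if "j < K" for j
    using Upd.prems(4,5) that nth_mem by blast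
  then show ?case
    using Upd.prems by auto
next
  case (Seq P Q)
  show ?case
  proof (cases "q < l + prog_states P")
    case True
    then have "(q' = l + prog_states P \<or> l \<le> q' \<and> q' < l + prog_states P) \<and>
        length acts = K \<and> fst ` set acts \<subseteq> {..<3}"
      using Seq.prems by (intro Seq.IH(1)[of l "l + prog_states P"]) auto
    then show ?thesis
      using prog_states_pos[of Q] by auto
  next
    case False
    then have "(q' = e \<or> l + prog_states P \<le> q' \<and> q' < l + prog_states P + prog_states Q) \<and>
        length acts = K \<and> fst ` set acts \<subseteq> {..<3}"
      using Seq.prems by (intro Seq.IH(2)[of "l + prog_states P" e]) auto
    then show ?thesis
      by auto
  qed
next
  case (While c P)
  show ?case
  proof (cases "q = l")
    case True
    then show ?thesis
      using While.prems prog_states_pos[of P] by (auto simp: image_image)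
  next
    case False
    then have "(q' = l \<or> Suc l \<le> q' \<and> q' < Suc l + prog_states P) \<and>
        length acts = K \<and> fst ` set acts \<subseteq> {..<3}"
      using While.prems by (intro While.IH[of "Suc l" l]) auto
    then show ?thesis
      by auto
  qed
qed

text \<open>\<open>M\<close> is any machine that agrees with the compiled code on the interval of
  states occupied by \<open>P\<close>. This generality lets the induction pass to subprograms with
  other entry and exit states. The step counts agree exactly.\<close>

lemma exec_tm_steps:
  assumes "exec P s t s'" "wf_prog K P"
    and "\<And>q. l \<le> q \<Longrightarrow> q < l + prog_states P \<Longrightarrow> q \<noteq> halt M"
    and "\<And>q ss. l \<le> q \<Longrightarrow> q < l + prog_states P \<Longrightarrow> length ss = K \<Longrightarrow>
      trans M q ss = prog_trans P l e q ss"
  shows "(tm_step M ^^ t) (l, map s [0..<K]) = (e, map s' [0..<K])"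
  using assms
proof (induction arbitrary: l e rule: exec.induct)
  case (Upd i f m s)
  let ?ss = "map (\<lambda>t. t 0) (map s [0..<K])"
  \<comment> \<open>Beyond index \<open>K\<close> the list lookup is arbitrary; locality in
    \<open>wf_prog\<close> makes this irrelevant.\<close>
  have f: "f ((!) ?ss) = f (\<lambda>j. s j 0)"
    using Upd.prems(1) by auto
  have "trans M l ?ss = (e, map (\<lambda>j. if j = i then (f (\<lambda>j. s j 0), m) else (s j 0, Stay)) [0..<K])"
    using Upd.prems(3)[of l ?ss] unfolding f[symmetric] by (auto simp: comp_def)
  then have "tm_step M (l, map s [0..<K]) = (e, map2 (\<lambda>(s, m) t. move_head m (t(0 := s)))
      (map (\<lambda>j. if j = i then (f (\<lambda>j. s j 0), m) else (s j 0, Stay)) [0..<K]) (map s [0..<K]))"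
    using Upd.prems(2)[of l] by (intro tm_step_trans) auto
  then show ?case
    by (auto intro!: nth_equalityI)
next
  case (Seq P s t s' Q t' s'')
  have "(tm_step M ^^ t) (l, map s [0..<K]) = (l + prog_states P, map s' [0..<K])"
    using Seq.prems by (intro Seq.IH(1)) auto
  moreover have "(tm_step M ^^ t') (l + prog_states P, map s' [0..<K]) = (e, map s'' [0..<K])"
    using Seq.prems by (intro Seq.IH(2)) auto
  ultimately show ?case
    by (simp add: add.commute[of t] funpow_add)
next
  case (While_False c s P)
  let ?ss = "map (\<lambda>t. t 0) (map s [0..<K])"
  have "c ((!) ?ss) = c (\<lambda>j. s j 0)"
    using While_False.prems(1) by auto
  then have "trans M l ?ss = (e, map (\<lambda>s. (s, Stay)) ?ss)"
    using While_False.prems(3)[of l ?ss] While_False.hyps by simp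
  then have "tm_step M (l, map s [0..<K]) = (e, map2 (\<lambda>(s, m) t. move_head m (t(0 := s)))
      (map (\<lambda>s. (s, Stay)) ?ss) (map s [0..<K]))"
    using While_False.prems(2)[of l] by (intro tm_step_trans) auto
  then show ?case
    using map2_idle[of ?ss "map s [0..<K]"] by simp
next
  case (While_True c s P t s' t' s'')
  let ?ss = "map (\<lambda>t. t 0) (map s [0..<K])"
  have "c ((!) ?ss) = c (\<lambda>j. s j 0)"
    using While_True.prems(1) by auto
  then have "trans M l ?ss = (Suc l, map (\<lambda>s. (s, Stay)) ?ss)"
    using While_True.prems(3)[of l ?ss] While_True.hyps by simp
  then have "tm_step M (l, map s [0..<K]) = (Suc l, map2 (\<lambda>(s, m) t. move_head m (t(0 := s)))
      (map (\<lambda>s. (s, Stay)) ?ss) (map s [0..<K]))"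
    using While_True.prems(2)[of l] by (intro tm_step_trans) auto
  then have 1: "tm_step M (l, map s [0..<K]) = (Suc l, map s [0..<K])"
    using map2_idle[of ?ss "map s [0..<K]"] by simp
  have 2: "(tm_step M ^^ t) (Suc l, map s [0..<K]) = (l, map s' [0..<K])"
    using While_True.prems by (intro While_True.IH(1)) auto
  have 3: "(tm_step M ^^ t') (l, map s' [0..<K]) = (e, map s'' [0..<K])"
    using While_True.prems by (intro While_True.IH(2)) auto
  have "1 + t + t' = t' + (t + 1)"
    by simp
  then show ?case
    by (simp only: funpow_add comp_apply) (simp add: 1 2 3)
qed

section \<open>Compiled machines and time bounds for programs\<close>

definition prog_tm :: "nat \<Rightarrow> prog \<Rightarrow> tm" where
  "prog_tm K P =
    \<lparr>tapes = K, symbols = 3, states = Suc (prog_states P), start = 0, halt = prog_states P,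
     trans = (\<lambda>q ss. if q < prog_states P then prog_trans P 0 (prog_states P) q ss
       else (q, map (\<lambda>s. (s, Stay)) ss))\<rparr>"

lemma wf_prog_tm:
  assumes "wf_prog K P" "0 < K"
  shows "wf_tm (prog_tm K P)"
proof -
  have "q' < Suc (prog_states P) \<and> length acts = K \<and> fst ` set acts \<subseteq> {..<3}"
    if "q < Suc (prog_states P)" "length ss = K" "set ss \<subseteq> {..<3}"
      "trans (prog_tm K P) q ss = (q', acts)" for q ss q' acts
  proof (cases "q < prog_states P")
    case True
    then show ?thesis
      using prog_trans_bounds[OF assms(1), of 0 q ss "prog_states P" q' acts] that
      by (auto simp: prog_tm_def)
  next
    case False
    then have "q' = q" "acts = map (\<lambda>s. (s, Stay)) ss"
      using that(4) by (simp_all add: prog_tm_def)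
    then show ?thesis
      using that by (auto simp: image_image)
  qed
  then have "\<forall>q ss. q < Suc (prog_states P) \<and> length ss = K \<and> set ss \<subseteq> {..<3} \<longrightarrow>
      (case trans (prog_tm K P) q ss of (q', acts) \<Rightarrow>
        q' < Suc (prog_states P) \<and> length acts = K \<and> fst ` set acts \<subseteq> {..<3})"
    by (intro allI impI case_prodI2) blast
  moreover have "tapes (prog_tm K P) = K" "symbols (prog_tm K P) = 3"
      "states (prog_tm K P) = Suc (prog_states P)" "start (prog_tm K P) = 0"
      "halt (prog_tm K P) = prog_states P"
    by (simp_all add: prog_tm_def)
  ultimately show ?thesis
    using assms(2) by (simp add: wf_tm_def)
qed

lemma string_tape_Nil: "string_tape [] = (\<lambda>_. 0)"
  by (auto simp: string_tape_def)

text \<open>An upper bound instead of the exact time of \<open>exec\<close>, so that all iterations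
  of a loop can share one bound.\<close>

definition runs :: "prog \<Rightarrow> (nat \<Rightarrow> tape) \<Rightarrow> nat \<Rightarrow> (nat \<Rightarrow> tape) \<Rightarrow> bool" where
  "runs P s T s' \<longleftrightarrow> (\<exists>t\<le>T. exec P s t s')"

lemma tm_computes_within_prog_tm:
  assumes "wf_prog K P" "0 < K" "runs P ((\<lambda>_ _. 0)(0 := string_tape x)) T s'"
    "s' 0 = string_tape y"
  shows "tm_computes_within (prog_tm K P) [x] y T"
proof -
  let ?M = "prog_tm K P"
  let ?s = "(\<lambda>_ _. 0)(0 := string_tape x)"
  obtain t where t: "t \<le> T" "exec P ?s t s'"
    using assms(3) by (auto simp: runs_def)
  have "[0..<K] = 0 # [1..<K]"
    using assms(2) by (simp add: upt_conv_Cons)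
  then have "init_config ?M [x] = (0, map ?s [0..<K])"
    by (auto simp: init_config_def prog_tm_def string_tape_Nil intro!: nth_equalityI)
  moreover have "(tm_step ?M ^^ t) (0, map ?s [0..<K]) = (prog_states P, map s' [0..<K])"
    using t(2) assms(1) by (intro exec_tm_steps) (auto simp: prog_tm_def)
  ultimately have "tm_computes_within ?M [x] y t"
    using assms(2,4) by (simp add: tm_computes_within_def prog_tm_def)
  then show ?thesis
    using t(1) by (rule tm_computes_within_mono)
qed

lemma runs_mono: "runs P s T s' \<Longrightarrow> T \<le> T' \<Longrightarrow> runs P s T' s'"
  unfolding runs_def by (meson order_trans)

lemma runs_weaken: "runs P s T s' \<Longrightarrow> s' = s'' \<Longrightarrow> T \<le> T' \<Longrightarrow> runs P s T' s''"
  using runs_mono by blast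

lemma runs_Upd:
  "s' = s(i := move_head m ((s i)(0 := f (\<lambda>j. s j 0)))) \<Longrightarrow> runs (Upd i f m) s 1 s'"
  unfolding runs_def by (auto intro!: exI[of _ 1] exec.Upd[simplified])

lemma runs_Seq: "runs P s T s' \<Longrightarrow> runs Q s' T' s'' \<Longrightarrow> runs (P ;; Q) s (T + T') s''"
  unfolding runs_def by (meson add_mono exec.Seq)

text \<open>\<open>S k\<close> is the state after \<open>k\<close> iterations. Each iteration pays
  one step for its test, and the failing test pays the final \<open>1\<close>.\<close>

lemma runs_While:
  assumes "\<And>k. k < n \<Longrightarrow> c (\<lambda>j. S k j 0) \<and> runs P (S k) B (S (Suc k))" "\<not> c (\<lambda>j. S n j 0)"
  shows "runs (While c P) (S 0) (n * (B + 1) + 1) (S n)"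
  using assms
proof (induction n arbitrary: S)
  case 0
  then show ?case
    using exec.While_False[of c "S 0" P] by (auto simp: runs_def)
next
  case (Suc n)
  have "runs (While c P) (S (Suc 0)) (n * (B + 1) + 1) (S (Suc n))"
    using Suc.prems by (intro Suc.IH[of "\<lambda>k. S (Suc k)"]) auto
  then obtain t' where t': "t' \<le> n * (B + 1) + 1" "exec (While c P) (S (Suc 0)) t' (S (Suc n))"
    by (auto simp: runs_def)
  obtain t where t: "t \<le> B" "exec P (S 0) t (S (Suc 0))" "c (\<lambda>j. S 0 j 0)"
    using Suc.prems(1)[of 0] by (auto simp: runs_def)
  have "exec (While c P) (S 0) (1 + t + t') (S (Suc n))"
    using t(2,3) t'(2) by (intro exec.While_True)
  moreover have "1 + t + t' \<le> Suc n * (B + 1) + 1"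
    using t(1) t'(1) by simp
  ultimately show ?case
    unfolding runs_def by blast
qed

section \<open>Head positions, rewinding and counted loops\<close>

definition shift_tape :: "int \<Rightarrow> tape \<Rightarrow> tape" where
  "shift_tape h t = (\<lambda>i. t (h + i))"

declare move_head.simps(1,3) [simp del]

text \<open>These restore absolute head positions: \<open>shift_tape h t\<close> is \<open>t\<close>
  with the head on cell \<open>h\<close>, and a move changes only \<open>h\<close>.\<close>

lemma shift_tape_simps [simp]:
  "move_head Move_Left (shift_tape h t) = shift_tape (h - 1) t"
  "move_head Move_Right (shift_tape h t) = shift_tape (h + 1) t"
  "shift_tape 0 t = t"
  by (auto simp: shift_tape_def move_head.simps algebra_simps)

lemma shift_string_tape_0:
  "shift_tape h (string_tape w) 0 =
    (if 0 \<le> h \<and> h < int (length w) then if w ! nat h then 2 else 1 else 0)"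
  by (simp add: shift_tape_def string_tape_def)

abbreviation Mv :: "nat \<Rightarrow> head_move \<Rightarrow> prog" where
  "Mv i m \<equiv> Upd i (\<lambda>r. r i) m"

lemma runs_Mv: "s' = s(i := move_head m (s i)) \<Longrightarrow> runs (Mv i m) s 1 s'"
  by (rule runs_Upd) (simp add: fun_upd_idem)

text \<open>A tape being appended to, with the head on the blank just after
  \<open>w\<close>.\<close>

definition written_tape :: "bool list \<Rightarrow> tape" where
  "written_tape w = shift_tape (int (length w)) (string_tape w)"

lemma written_tape_Nil: "written_tape [] = string_tape []"
  by (simp add: written_tape_def)

lemma written_tape_snoc:
  "move_head Move_Right ((written_tape w)(0 := if b then 2 else 1)) = written_tape (w @ [b])"
  by (rule ext) (auto simp: move_head.simps written_tape_def shift_tape_def string_tape_def nth_append ac_simps)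

lemma written_tape_replicate_Suc:
  "move_head Move_Right ((written_tape (replicate k True))(0 := 2)) =
    written_tape (replicate (Suc k) True)"
  using written_tape_snoc[of "replicate k True" True] by (simp add: replicate_append_same)

lemma string_tape_Cons_0: "string_tape (b # w) 0 = (if b then 2 else 1)"
  by (simp add: string_tape_def)

text \<open>Consuming input destructively leaves exactly the tape of the remaining string, and
  finally a blank tape ready for output.\<close>

lemma erase_string_tape: "move_head Move_Right ((string_tape (b # w))(0 := 0)) = string_tape w"
  by (rule ext) (auto simp: move_head.simps string_tape_def nth_Cons nat_add_distrib split: nat.split)

text \<open>The first left move is needed because the head may stand on the blank after the string,
  where the loop would stop at once. Both bits are nonblank, so the loop ends only to the left of
  the string.\<close>

definition rewind :: "nat \<Rightarrow> prog" where
  "rewind c = Mv c Move_Left ;; While (\<lambda>r. r c \<noteq> 0) (Mv c Move_Left) ;; Mv c Move_Right"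

lemma runs_rewind:
  assumes c: "s c = shift_tape (int h) (string_tape w)" and h: "h \<le> length w"
  shows "runs (rewind c) s (2 * h + 3) (s(c := string_tape w))"
proof -
  define S where "S k = s(c := shift_tape (int h - 1 - int k) (string_tape w))" for k
  have "runs (Mv c Move_Left) s 1 (S 0)"
    by (rule runs_Mv) (simp add: S_def c)
  moreover have "runs (While (\<lambda>r. r c \<noteq> 0) (Mv c Move_Left)) (S 0) (h * (1 + 1) + 1) (S h)"
  proof (rule runs_While, intro conjI)
    fix k assume "k < h"
    then show "S k c 0 \<noteq> 0"
      using h by (simp add: S_def shift_string_tape_0)
    show "runs (Mv c Move_Left) (S k) 1 (S (Suc k))"
      by (rule runs_Mv) (simp add: S_def algebra_simps)
  qed (simp add: S_def shift_string_tape_0)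
  moreover have "runs (Mv c Move_Right) (S h) 1 (s(c := string_tape w))"
    by (rule runs_Mv) (simp add: S_def)
  ultimately have "runs (rewind c) s (1 + (h * (1 + 1) + 1 + 1)) (s(c := string_tape w))"
    unfolding rewind_def by (intro runs_Seq)
  then show ?thesis
    by (rule runs_mono) simp
qed

lemma runs_rewind_written:
  assumes "s c = written_tape w"
  shows "runs (rewind c) s (2 * length w + 3) (s(c := string_tape w))"
  using runs_rewind[of s c "length w" w] assms by (simp add: written_tape_def)

text \<open>The counter is a head position on a unary string that is never altered and is rewound at
  the end, so inner loops can be run again and again.\<close>

definition For :: "nat \<Rightarrow> prog \<Rightarrow> prog" where
  "For c P = While (\<lambda>r. r c \<noteq> 0) (P ;; Mv c Move_Right) ;; rewind c"

definition unary_tape :: "nat \<Rightarrow> nat \<Rightarrow> tape" where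
  "unary_tape n h = shift_tape (int h) (string_tape (replicate n True))"

text \<open>The argument \<open>h\<close> of the invariant \<open>S k h\<close> is the head position on the loop counter \<open>c\<close>, and \<open>k\<close>
  counts the completed iterations.\<close>

lemma runs_For:
  assumes c: "\<And>k h. S k h c = unary_tape n h"
    and upd: "\<And>k h h'. (S k h)(c := unary_tape n h') = S k h'"
    and body: "\<And>k. k < n \<Longrightarrow> runs P (S k k) B (S (Suc k) k)"
  shows "runs (For c P) (S 0 0) (n * (B + 4) + 4) (S n 0)"
proof -
  have "runs (While (\<lambda>r. r c \<noteq> 0) (P ;; Mv c Move_Right)) (S 0 0) (n * (B + 1 + 1) + 1) (S n n)"
  proof (rule runs_While[where S = "\<lambda>k. S k k"], intro conjI)
    fix k assume k: "k < n"
    then show "S k k c 0 \<noteq> 0"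
      by (simp add: c unary_tape_def shift_string_tape_0)
    have "runs (Mv c Move_Right) (S (Suc k) k) 1 (S (Suc k) (Suc k))"
    proof (rule runs_Mv)
      have "move_head Move_Right (unary_tape n k) = unary_tape n (Suc k)"
        by (simp add: unary_tape_def add.commute)
      then show "S (Suc k) (Suc k) = (S (Suc k) k)(c := move_head Move_Right (S (Suc k) k c))"
        by (simp add: c upd)
    qed
    then show "runs (P ;; Mv c Move_Right) (S k k) (B + 1) (S (Suc k) (Suc k))"
      using body[OF k] by (intro runs_Seq)
  qed (simp add: c unary_tape_def shift_string_tape_0)
  moreover have "runs (rewind c) (S n n) (2 * n + 3) (S n 0)"
    using runs_rewind[of "S n n" c n "replicate n True"] upd[of n n 0] c[of n n]
    by (simp add: unary_tape_def)
  ultimately have "runs (For c P) (S 0 0) (n * (B + 1 + 1) + 1 + (2 * n + 3)) (S n 0)"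
    unfolding For_def by (rule runs_Seq)
  then show ?thesis
    by (rule runs_mono) (simp add: algebra_simps)
qed

section \<open>Computing the arc graph\<close>

text \<open>Tape 0 holds the output. Tapes 1 and 2 hold the adjacency matrix, scanned at the arcs \<open>(u, v)\<close>
  and \<open>(u', v')\<close>. Tapes 3 to 6 are unary counters for \<open>u\<close>, \<open>v\<close>, \<open>u'\<close>, \<open>v'\<close>. Tapes 7 and 8 carry a
  single mark; their head positions are kept at \<open>u' - v\<close> and \<open>v' - u\<close>, so that scanning the mark
  tests \<open>u' = v\<close> and \<open>v' = u\<close>.\<close>

definition loop_state ::
  "nat \<Rightarrow> bool list \<Rightarrow> bool list \<Rightarrow> nat \<Rightarrow> nat \<Rightarrow> nat \<Rightarrow> nat \<Rightarrow> nat \<Rightarrow> nat \<Rightarrow> int \<Rightarrow> int \<Rightarrow> nat \<Rightarrow> tape"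
  where
  "loop_state n bs ys a b u v u' v' d e = (\<lambda>_ _. 0)(0 := written_tape ys,
     1 := shift_tape (int a) (string_tape bs), 2 := shift_tape (int b) (string_tape bs),
     3 := unary_tape n u, 4 := unary_tape n v, 5 := unary_tape n u', 6 := unary_tape n v',
     7 := shift_tape d (string_tape [True]), 8 := shift_tape e (string_tape [True]))"

lemma loop_state_sel [simp]:
  "loop_state n bs ys a b u v u' v' d e 0 = written_tape ys"
  "loop_state n bs ys a b u v u' v' d e (Suc 0) = shift_tape (int a) (string_tape bs)"
  "loop_state n bs ys a b u v u' v' d e 2 = shift_tape (int b) (string_tape bs)"
  "loop_state n bs ys a b u v u' v' d e 3 = unary_tape n u"
  "loop_state n bs ys a b u v u' v' d e 4 = unary_tape n v"
  "loop_state n bs ys a b u v u' v' d e 5 = unary_tape n u'"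
  "loop_state n bs ys a b u v u' v' d e 6 = unary_tape n v'"
  "loop_state n bs ys a b u v u' v' d e 7 = shift_tape d (string_tape [True])"
  "loop_state n bs ys a b u v u' v' d e 8 = shift_tape e (string_tape [True])"
  by (simp_all add: loop_state_def)

lemma loop_state_upd [simp]:
  "(loop_state n bs ys a b u v u' v' d e)(0 := written_tape zs) = loop_state n bs zs a b u v u' v' d e"
  "(loop_state n bs ys a b u v u' v' d e)(Suc 0 := shift_tape (int i) (string_tape bs)) =
     loop_state n bs ys i b u v u' v' d e"
  "(loop_state n bs ys a b u v u' v' d e)(2 := shift_tape (int i) (string_tape bs)) =
     loop_state n bs ys a i u v u' v' d e"
  "(loop_state n bs ys a b u v u' v' d e)(3 := unary_tape n i) = loop_state n bs ys a b i v u' v' d e"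
  "(loop_state n bs ys a b u v u' v' d e)(4 := unary_tape n i) = loop_state n bs ys a b u i u' v' d e"
  "(loop_state n bs ys a b u v u' v' d e)(5 := unary_tape n i) = loop_state n bs ys a b u v i v' d e"
  "(loop_state n bs ys a b u v u' v' d e)(6 := unary_tape n i) = loop_state n bs ys a b u v u' i d e"
  "(loop_state n bs ys a b u v u' v' d e)(7 := shift_tape j (string_tape [True])) =
     loop_state n bs ys a b u v u' v' j e"
  "(loop_state n bs ys a b u v u' v' d e)(8 := shift_tape j (string_tape [True])) =
     loop_state n bs ys a b u v u' v' d j"
  by (simp_all add: loop_state_def fun_eq_iff)

lemma runs_moves:
  "runs (Mv 1 Move_Right) (loop_state n bs ys a b u v u' v' d e) 1 (loop_state n bs ys (Suc a) b u v u' v' d e)"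
  "runs (Mv 2 Move_Right) (loop_state n bs ys a b u v u' v' d e) 1 (loop_state n bs ys a (Suc b) u v u' v' d e)"
  "runs (Mv 7 Move_Right) (loop_state n bs ys a b u v u' v' d e) 1 (loop_state n bs ys a b u v u' v' (d + 1) e)"
  "runs (Mv 7 Move_Left) (loop_state n bs ys a b u v u' v' d e) 1 (loop_state n bs ys a b u v u' v' (d - 1) e)"
  "runs (Mv 8 Move_Right) (loop_state n bs ys a b u v u' v' d e) 1 (loop_state n bs ys a b u v u' v' d (e + 1))"
  "runs (Mv 8 Move_Left) (loop_state n bs ys a b u v u' v' d e) 1 (loop_state n bs ys a b u v u' v' d (e - 1))"
  using loop_state_upd(2)[of n bs ys a b u v u' v' d e "Suc a"]
    loop_state_upd(3)[of n bs ys a b u v u' v' d e "Suc b"]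
  by (intro runs_Mv; simp add: add.commute)+

definition emit :: "bool \<Rightarrow> prog" where
  "emit symm = Upd 0 (\<lambda>r. if r 1 = 2 \<and> r 2 = 2 \<and> (r 7 = 2 \<or> symm \<and> r 8 = 2) then 2 else 1) Move_Right"

text \<open>The second loop takes back the \<open>n\<close> right moves on tape 8, since
  \<open>v'\<close> restarts at 0. Tape 2 is not taken back: the next row of the matrix follows
  directly. The last move accounts for the increase of \<open>u'\<close>.\<close>

definition arc_row :: "bool \<Rightarrow> prog" where
  "arc_row symm =
     For 6 (emit symm ;; Mv 2 Move_Right ;; Mv 8 Move_Right) ;;
     For 6 (Mv 8 Move_Left) ;; Mv 7 Move_Right"

text \<open>After all \<open>u'\<close>, tape 7 goes back \<open>n\<close> cells and one further
  because \<open>v\<close> increases. Tape 2 has passed the whole matrix and is rewound; tape 1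
  advances to the next pair \<open>(u, v)\<close>.\<close>

definition arc_rows :: "bool \<Rightarrow> prog" where
  "arc_rows symm =
     For 5 (arc_row symm) ;; For 5 (Mv 7 Move_Left) ;; Mv 7 Move_Left ;; rewind 2 ;; Mv 1 Move_Right"

definition arc_block :: "bool \<Rightarrow> prog" where
  "arc_block symm = For 4 (arc_rows symm) ;; For 4 (Mv 7 Move_Right) ;; Mv 8 Move_Left"

definition load :: prog where
  "load = Upd 7 (\<lambda>_. 2) Stay ;; Upd 8 (\<lambda>_. 2) Stay ;;
     While (\<lambda>r. r 0 = 2)
       (Upd 3 (\<lambda>_. 2) Move_Right ;; Upd 4 (\<lambda>_. 2) Move_Right ;; Upd 5 (\<lambda>_. 2) Move_Right ;;
        Upd 6 (\<lambda>_. 2) Move_Right ;; Upd 0 (\<lambda>_. 0) Move_Right) ;;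
     Upd 0 (\<lambda>_. 0) Move_Right ;;
     While (\<lambda>r. r 0 \<noteq> 0)
       (Upd 1 (\<lambda>r. r 0) Move_Right ;; Upd 2 (\<lambda>r. r 0) Move_Right ;; Upd 0 (\<lambda>_. 0) Move_Right) ;;
     rewind 1 ;; rewind 2 ;; rewind 3 ;; rewind 4 ;; rewind 5 ;; rewind 6"

definition arc_prog :: "bool \<Rightarrow> prog" where
  "arc_prog symm = load ;;
     For 3 (For 4 (Upd 0 (\<lambda>_. 2) Move_Right)) ;; Upd 0 (\<lambda>_. 1) Move_Right ;;
     For 3 (arc_block symm) ;; rewind 0"

definition arc_bit :: "bool \<Rightarrow> nat \<Rightarrow> bool list \<Rightarrow> nat \<Rightarrow> nat \<Rightarrow> nat \<Rightarrow> nat \<Rightarrow> bool" where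
  "arc_bit symm n bs u v u' v' \<longleftrightarrow>
     bs ! (u * n + v) \<and> bs ! (u' * n + v') \<and> (u' = v \<or> symm \<and> v' = u)"

lemma wf_arc_prog: "wf_prog 9 (arc_prog symm)"
  by (auto simp: arc_prog_def load_def arc_block_def arc_rows_def arc_row_def emit_def For_def
      rewind_def)

lemma runs_emit:
  assumes "length bs = n * n" "u < n" "v < n" "u' < n" "v' < n"
  shows "runs (emit symm)
    (loop_state n bs ys (u * n + v) (u' * n + v') u v i j (int u' - int v) (int v' - int u)) 1
    (loop_state n bs (ys @ [arc_bit symm n bs u v u' v']) (u * n + v) (u' * n + v') u v i j
      (int u' - int v) (int v' - int u))"
  unfolding emit_def
proof (rule runs_Upd)
  let ?s = "loop_state n bs ys (u * n + v) (u' * n + v') u v i j (int u' - int v) (int v' - int u)"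
  \<comment> \<open>The mark occupies cell 0 only, so tape 7 shows it just when
    \<open>u' = v\<close>, and tape 8 just when \<open>v' = u\<close>. By \<open>pair_index\<close>
    tapes 1 and 2 are scanned inside the matrix.\<close>
  have "(if ?s 1 0 = 2 \<and> ?s 2 0 = 2 \<and> (?s 7 0 = 2 \<or> symm \<and> ?s 8 0 = 2) then 2 else 1) =
      (if arc_bit symm n bs u v u' v' then 2 else (1 :: nat))"
    using assms pair_index(1)[of u n v] pair_index(1)[of u' n v']
    by (auto simp: arc_bit_def shift_string_tape_0 simp flip: of_nat_add of_nat_mult)
  then show "loop_state n bs (ys @ [arc_bit symm n bs u v u' v']) (u * n + v) (u' * n + v') u v i j
      (int u' - int v) (int v' - int u) = ?s(0 := move_head Move_Right ((?s 0)
        (0 := if ?s 1 0 = 2 \<and> ?s 2 0 = 2 \<and> (?s 7 0 = 2 \<or> symm \<and> ?s 8 0 = 2) then 2 else 1)))"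
    by (simp only: loop_state_sel written_tape_snoc loop_state_upd)
qed

lemma runs_arc_row:
  assumes "length bs = n * n" "u < n" "v < n" "u' < n"
  shows "runs (arc_row symm)
    (loop_state n bs ys (u * n + v) (u' * n) u v u' 0 (int u' - int v) (- int u)) (12 * n + 9)
    (loop_state n bs (ys @ map (arc_bit symm n bs u v u') [0..<n]) (u * n + v) (Suc u' * n) u v u' 0
      (int (Suc u') - int v) (- int u))"
proof -
  let ?row = "\<lambda>k. map (arc_bit symm n bs u v u') [0..<k]"
  let ?d = "int u' - int v"
  define S where
    "S k h = loop_state n bs (ys @ ?row k) (u * n + v) (u' * n + k) u v u' h ?d (int k - int u)" for k h
  have "runs (For 6 (emit symm ;; Mv 2 Move_Right ;; Mv 8 Move_Right)) (S 0 0) (n * (3 + 4) + 4) (S n 0)"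
  proof (rule runs_For)
    fix k assume "k < n"
    have "runs (emit symm ;; Mv 2 Move_Right ;; Mv 8 Move_Right) (S k k) (1 + (1 + 1))
        (loop_state n bs ((ys @ ?row k) @ [arc_bit symm n bs u v u' k]) (u * n + v) (Suc (u' * n + k))
          u v u' k ?d (int k - int u + 1))"
      unfolding S_def
      by (rule runs_Seq[OF runs_emit[OF assms \<open>k < n\<close>] runs_Seq[OF runs_moves(2) runs_moves(5)]])
    then show "runs (emit symm ;; Mv 2 Move_Right ;; Mv 8 Move_Right) (S k k) 3 (S (Suc k) k)"
      by (simp add: S_def algebra_simps numeral_3_eq_3)
  qed (simp_all add: S_def)
  moreover define S' where
    "S' k h = loop_state n bs (ys @ ?row n) (u * n + v) (u' * n + n) u v u' h ?d (int n - int u - int k)"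
    for k h
  have "runs (For 6 (Mv 8 Move_Left)) (S' 0 0) (n * (1 + 4) + 4) (S' n 0)"
  proof (rule runs_For)
    fix k
    show "runs (Mv 8 Move_Left) (S' k k) 1 (S' (Suc k) k)"
      using runs_moves(6)[of n bs "ys @ ?row n" "u * n + v" "u' * n + n" u v u' k ?d "int n - int u - int k"]
      by (simp add: S'_def algebra_simps)
  qed (simp_all add: S'_def)
  moreover have eq: "S n 0 = S' 0 0"
    by (simp add: S_def S'_def)
  moreover have "runs (Mv 7 Move_Right) (S' n 0) 1
      (loop_state n bs (ys @ ?row n) (u * n + v) (u' * n + n) u v u' 0 (?d + 1) (int n - int u - int n))"
    unfolding S'_def by (rule runs_moves)
  ultimately have "runs (arc_row symm) (S 0 0) (n * (3 + 4) + 4 + (n * (1 + 4) + 4 + 1))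
      (loop_state n bs (ys @ ?row n) (u * n + v) (u' * n + n) u v u' 0 (?d + 1) (int n - int u - int n))"
    unfolding arc_row_def eq by (intro runs_Seq)
  then have "runs (arc_row symm) (S 0 0) (12 * n + 9)
      (loop_state n bs (ys @ ?row n) (u * n + v) (u' * n + n) u v u' 0 (?d + 1) (int n - int u - int n))"
    by (rule runs_mono) simp
  then show ?thesis
    by (simp add: S_def algebra_simps)
qed

lemma runs_arc_rows:
  assumes bs: "length bs = n * n" and uv: "u < n" "v < n"
  shows "runs (arc_rows symm)
    (loop_state n bs ys (u * n + v) 0 u v 0 0 (- int v) (- int u)) (n * (14 * n + 18) + 13)
    (loop_state n bs (ys @ concat (map (\<lambda>u'. map (arc_bit symm n bs u v u') [0..<n]) [0..<n]))
      (u * n + Suc v) 0 u v 0 0 (- int (Suc v)) (- int u))"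
proof -
  let ?rows = "\<lambda>k. concat (map (\<lambda>u'. map (arc_bit symm n bs u v u') [0..<n]) [0..<k])"
  define S where
    "S k h = loop_state n bs (ys @ ?rows k) (u * n + v) (k * n) u v h 0 (int k - int v) (- int u)" for k h
  have "runs (For 5 (arc_row symm)) (S 0 0) (n * (12 * n + 9 + 4) + 4) (S n 0)"
  proof (rule runs_For)
    fix k assume k: "k < n"
    show "runs (arc_row symm) (S k k) (12 * n + 9) (S (Suc k) k)"
      using runs_arc_row[OF bs uv k, of symm "ys @ ?rows k"] by (simp add: S_def)
  qed (simp_all add: S_def)
  moreover define S' where
    "S' k h = loop_state n bs (ys @ ?rows n) (u * n + v) (n * n) u v h 0 (int n - int v - int k) (- int u)"
    for k h
  have "runs (For 5 (Mv 7 Move_Left)) (S' 0 0) (n * (1 + 4) + 4) (S' n 0)"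
  proof (rule runs_For)
    fix k
    show "runs (Mv 7 Move_Left) (S' k k) 1 (S' (Suc k) k)"
      using runs_moves(4)[of n bs "ys @ ?rows n" "u * n + v" "n * n" u v k 0 "int n - int v - int k" "- int u"]
      by (simp add: S'_def algebra_simps)
  qed (simp_all add: S'_def)
  moreover have eq: "S n 0 = S' 0 0"
    by (simp add: S_def S'_def)
  moreover define s1 where
    "s1 = loop_state n bs (ys @ ?rows n) (u * n + v) (n * n) u v 0 0 (int n - int v - int n - 1) (- int u)"
  have "runs (Mv 7 Move_Left) (S' n 0) 1 s1"
    unfolding S'_def s1_def by (rule runs_moves)
  moreover define s2 where
    "s2 = loop_state n bs (ys @ ?rows n) (u * n + v) 0 u v 0 0 (int n - int v - int n - 1) (- int u)"
  have "runs (rewind 2) s1 (2 * (n * n) + 3) s2"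
    using runs_rewind[of s1 2 "n * n" bs] bs
      loop_state_upd(3)[of n bs "ys @ ?rows n" "u * n + v" "n * n" u v 0 0 "int n - int v - int n - 1" "- int u" 0]
    by (simp add: s1_def s2_def)
  moreover define s3 where
    "s3 = loop_state n bs (ys @ ?rows n) (Suc (u * n + v)) 0 u v 0 0 (int n - int v - int n - 1) (- int u)"
  have "runs (Mv 1 Move_Right) s2 1 s3"
    unfolding s2_def s3_def by (rule runs_moves)
  ultimately have "runs (arc_rows symm) (S 0 0)
      (n * (12 * n + 9 + 4) + 4 + (n * (1 + 4) + 4 + (1 + (2 * (n * n) + 3 + 1)))) s3"
    unfolding arc_rows_def eq by (intro runs_Seq)
  then have "runs (arc_rows symm) (S 0 0) (n * (14 * n + 18) + 13) s3"
    by (rule runs_mono) (simp add: algebra_simps)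
  moreover have "s3 = loop_state n bs (ys @ ?rows n) (u * n + Suc v) 0 u v 0 0 (- int (Suc v)) (- int u)"
    unfolding s3_def by (rule arg_cong2[where f = "\<lambda>a d. loop_state n bs _ a 0 u v 0 0 d _"]) auto
  ultimately show ?thesis
    by (simp add: S_def)
qed

lemma runs_arc_block:
  assumes bs: "length bs = n * n" and u: "u < n"
  shows "runs (arc_block symm)
    (loop_state n bs ys (u * n) 0 u 0 0 0 0 (- int u)) (n * (n * (14 * n + 18) + 22) + 9)
    (loop_state n bs (ys @ concat (map (\<lambda>v. concat (map (\<lambda>u'. map (arc_bit symm n bs u v u') [0..<n])
      [0..<n])) [0..<n])) (Suc u * n) 0 u 0 0 0 0 (- int (Suc u)))"
proof -
  let ?block = "\<lambda>k. concat (map (\<lambda>v. concat (map (\<lambda>u'. map (arc_bit symm n bs u v u') [0..<n])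
    [0..<n])) [0..<k])"
  define S where "S k h = loop_state n bs (ys @ ?block k) (u * n + k) 0 u h 0 0 (- int k) (- int u)" for k h
  have "runs (For 4 (arc_rows symm)) (S 0 0) (n * (n * (14 * n + 18) + 13 + 4) + 4) (S n 0)"
  proof (rule runs_For)
    fix k assume k: "k < n"
    show "runs (arc_rows symm) (S k k) (n * (14 * n + 18) + 13) (S (Suc k) k)"
      using runs_arc_rows[OF bs u k, of symm "ys @ ?block k"] by (simp add: S_def)
  qed (simp_all add: S_def)
  moreover define S' where
    "S' k h = loop_state n bs (ys @ ?block n) (u * n + n) 0 u h 0 0 (int k - int n) (- int u)" for k h
  have "runs (For 4 (Mv 7 Move_Right)) (S' 0 0) (n * (1 + 4) + 4) (S' n 0)"
  proof (rule runs_For)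
    fix k
    show "runs (Mv 7 Move_Right) (S' k k) 1 (S' (Suc k) k)"
      using runs_moves(3)[of n bs "ys @ ?block n" "u * n + n" 0 u k 0 0 "int k - int n" "- int u"]
      by (simp add: S'_def algebra_simps)
  qed (simp_all add: S'_def)
  moreover have eq: "S n 0 = S' 0 0"
    by (simp add: S_def S'_def)
  moreover define s1 where
    "s1 = loop_state n bs (ys @ ?block n) (u * n + n) 0 u 0 0 0 (int n - int n) (- int u - 1)"
  have "runs (Mv 8 Move_Left) (S' n 0) 1 s1"
    unfolding S'_def s1_def by (rule runs_moves)
  ultimately have "runs (arc_block symm) (S 0 0)
      (n * (n * (14 * n + 18) + 13 + 4) + 4 + (n * (1 + 4) + 4 + 1)) s1"
    unfolding arc_block_def eq by (intro runs_Seq)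
  then have "runs (arc_block symm) (S 0 0) (n * (n * (14 * n + 18) + 22) + 9) s1"
    by (rule runs_mono) (simp add: algebra_simps)
  moreover have "- int u - 1 = - int (Suc u)"
    by simp
  ultimately show ?thesis
    unfolding S_def s1_def by (simp add: add.commute)
qed

text \<open>Tapes 1 and 8 end displaced by \<open>n * n\<close> and \<open>- int n\<close>; this is
  harmless because only tape 0 is used afterwards.\<close>

lemma runs_arc_blocks:
  assumes bs: "length bs = n * n"
  shows "runs (For 3 (arc_block symm)) (loop_state n bs ys 0 0 0 0 0 0 0 0)
    (n * (n * (n * (14 * n + 18) + 22) + 13) + 4)
    (loop_state n bs (ys @ arc_matrix symm n bs) (n * n) 0 0 0 0 0 0 (- int n))"
proof -
  let ?blocks = "\<lambda>k. concat (map (\<lambda>u. concat (map (\<lambda>v. concat (map (\<lambda>u'. map (arc_bit symm n bs u v u')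
    [0..<n]) [0..<n])) [0..<n])) [0..<k])"
  define S where "S k h = loop_state n bs (ys @ ?blocks k) (k * n) 0 h 0 0 0 0 (- int k)" for k h
  have "runs (For 3 (arc_block symm)) (S 0 0) (n * (n * (n * (14 * n + 18) + 22) + 9 + 4) + 4) (S n 0)"
  proof (rule runs_For)
    fix k assume k: "k < n"
    show "runs (arc_block symm) (S k k) (n * (n * (14 * n + 18) + 22) + 9) (S (Suc k) k)"
      using runs_arc_block[OF bs k, of symm "ys @ ?blocks k"] by (simp add: S_def)
  qed (simp_all add: S_def)
  then have "runs (For 3 (arc_block symm)) (S 0 0) (n * (n * (n * (14 * n + 18) + 22) + 13) + 4) (S n 0)"
    by (rule runs_mono) simp
  moreover have "arc_matrix symm n bs = ?blocks n"
    by (simp add: arc_matrix_def arc_bit_def[abs_def])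
  ultimately show ?thesis
    by (simp add: S_def)
qed

lemma runs_write:
  "runs (Upd 0 (\<lambda>_. 2) Move_Right) (loop_state n bs ys a b u v u' v' d e) 1
    (loop_state n bs (ys @ [True]) a b u v u' v' d e)"
  "runs (Upd 0 (\<lambda>_. 1) Move_Right) (loop_state n bs ys a b u v u' v' d e) 1
    (loop_state n bs (ys @ [False]) a b u v u' v' d e)"
  using written_tape_snoc[of ys True] written_tape_snoc[of ys False]
  by (intro runs_Upd; simp only: if_True if_False loop_state_sel loop_state_upd)+

lemma runs_vertex_count:
  "runs (For 3 (For 4 (Upd 0 (\<lambda>_. 2) Move_Right))) (loop_state n bs [] 0 0 0 0 0 0 0 0)
    (n * (n * 5 + 8) + 4) (loop_state n bs (replicate (n * n) True) 0 0 0 0 0 0 0 0)"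
proof -
  define S where "S k h = loop_state n bs (replicate (k * n) True) 0 0 h 0 0 0 0 0" for k h
  have "runs (For 3 (For 4 (Upd 0 (\<lambda>_. 2) Move_Right))) (S 0 0) (n * (n * (1 + 4) + 4 + 4) + 4) (S n 0)"
  proof (rule runs_For)
    fix k assume "k < n"
    define S' where "S' i h = loop_state n bs (replicate (k * n + i) True) 0 0 k h 0 0 0 0" for i h
    have "runs (For 4 (Upd 0 (\<lambda>_. 2) Move_Right)) (S' 0 0) (n * (1 + 4) + 4) (S' n 0)"
    proof (rule runs_For)
      fix i
      show "runs (Upd 0 (\<lambda>_. 2) Move_Right) (S' i i) 1 (S' (Suc i) i)"
        using runs_write(1)[of n bs "replicate (k * n + i) True"]
        by (simp add: S'_def replicate_append_same)
    qed (simp_all add: S'_def)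
    then show "runs (For 4 (Upd 0 (\<lambda>_. 2) Move_Right)) (S k k) (n * (1 + 4) + 4) (S (Suc k) k)"
      by (simp add: S_def S'_def add.commute)
  qed (simp_all add: S_def)
  then show ?thesis
    by (simp add: S_def add.commute)
qed

section \<open>Loading the input and the complete run of the program\<close>

definition load_state :: "bool list \<Rightarrow> bool list \<Rightarrow> nat \<Rightarrow> nat \<Rightarrow> tape" where
  "load_state xs bs m = (\<lambda>_ _. 0)(0 := string_tape xs, 1 := written_tape bs, 2 := written_tape bs,
     3 := written_tape (replicate m True), 4 := written_tape (replicate m True),
     5 := written_tape (replicate m True), 6 := written_tape (replicate m True),
     7 := string_tape [True], 8 := string_tape [True])"

lemma load_state_sel [simp]:
  "load_state xs bs m 0 = string_tape xs"
  "load_state xs bs m (Suc 0) = written_tape bs"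
  "load_state xs bs m 2 = written_tape bs"
  "load_state xs bs m 3 = written_tape (replicate m True)"
  "load_state xs bs m 4 = written_tape (replicate m True)"
  "load_state xs bs m 5 = written_tape (replicate m True)"
  "load_state xs bs m 6 = written_tape (replicate m True)"
  by (simp_all add: load_state_def)

text \<open>The unary prefix consists of symbols 2 and the separator is 1, so the first loop of
  \<open>load\<close> stops at the separator and the second at the blank after the matrix.\<close>

lemma runs_load:
  "runs load ((\<lambda>_ _. 0)(0 := string_tape (replicate n True @ False # bs))) (14 * n + 8 * length bs + 23)
    (loop_state n bs [] 0 0 0 0 0 0 0 0)"
proof -
  let ?w = "replicate n True @ False # bs"
  let ?s0 = "((\<lambda>_ _. 0) :: nat \<Rightarrow> tape)(0 := string_tape ?w)"
  let ?s1 = "?s0(7 := string_tape [True])"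
  have mark: "(\<lambda>_ :: int. 0 :: nat)(0 := 2) = string_tape [True]"
    by (rule ext) (auto simp: string_tape_def)
  define S where "S k = load_state (replicate (n - k) True @ False # bs) [] k" for k
  define S' where "S' k = load_state (drop k bs) (take k bs) n" for k
  have "runs (Upd 7 (\<lambda>_. 2) Stay) ?s0 1 ?s1"
    by (rule runs_Upd) (simp add: mark)
  moreover have "runs (Upd 8 (\<lambda>_. 2) Stay) ?s1 1 (S 0)"
  proof (rule runs_Upd)
    \<comment> \<open>Untouched blank tapes count as written tapes of the empty string.\<close>
    have "S 0 = ?s1(8 := string_tape [True])"
      by (simp add: S_def load_state_def written_tape_Nil string_tape_Nil fun_eq_iff)
    then show "S 0 = ?s1(8 := move_head Stay ((?s1 8)(0 := 2)))"
      by (simp add: mark)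
  qed
  moreover have "runs (While (\<lambda>r. r 0 = 2)
       (Upd 3 (\<lambda>_. 2) Move_Right ;; Upd 4 (\<lambda>_. 2) Move_Right ;; Upd 5 (\<lambda>_. 2) Move_Right ;;
        Upd 6 (\<lambda>_. 2) Move_Right ;; Upd 0 (\<lambda>_. 0) Move_Right)) (S 0) (n * (5 + 1) + 1) (S n)"
  proof (rule runs_While, intro conjI)
    fix k assume "k < n"
    then have Cons: "replicate (n - k) True = True # replicate (n - Suc k) True"
      by (metis Suc_diff_Suc replicate_Suc)
    show "S k 0 0 = 2"
      by (simp add: S_def Cons string_tape_def)
    show "runs (Upd 3 (\<lambda>_. 2) Move_Right ;; Upd 4 (\<lambda>_. 2) Move_Right ;; Upd 5 (\<lambda>_. 2) Move_Right ;;
        Upd 6 (\<lambda>_. 2) Move_Right ;; Upd 0 (\<lambda>_. 0) Move_Right) (S k) 5 (S (Suc k))"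
    \<comment> \<open>Unification computes the state after the five updates; only then is it
      compared with the next invariant.\<close>
    proof (rule runs_weaken, (rule runs_Seq, rule runs_Upd[OF refl])+, rule runs_Upd[OF refl], goal_cases)
      case 1
      show ?case
        unfolding S_def Cons
        by (simp add: written_tape_replicate_Suc erase_string_tape) (simp add: load_state_def fun_eq_iff)
    qed simp
  qed (simp add: S_def string_tape_def)
  moreover have "runs (Upd 0 (\<lambda>_. 0) Move_Right) (S n) 1 (S' 0)"
    by (rule runs_Upd) (simp add: S_def S'_def erase_string_tape, simp add: load_state_def fun_eq_iff)
  moreover have "runs (While (\<lambda>r. r 0 \<noteq> 0)
       (Upd 1 (\<lambda>r. r 0) Move_Right ;; Upd 2 (\<lambda>r. r 0) Move_Right ;; Upd 0 (\<lambda>_. 0) Move_Right))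
       (S' 0) (length bs * (3 + 1) + 1) (S' (length bs))"
  proof (rule runs_While, intro conjI)
    fix k assume k: "k < length bs"
    then have Cons: "drop k bs = bs ! k # drop (Suc k) bs"
      by (simp add: Cons_nth_drop_Suc)
    have snoc: "take (Suc k) bs = take k bs @ [bs ! k]"
      using k by (simp add: take_Suc_conv_app_nth)
    show "S' k 0 0 \<noteq> 0"
      by (simp add: S'_def Cons string_tape_Cons_0)
    show "runs (Upd 1 (\<lambda>r. r 0) Move_Right ;; Upd 2 (\<lambda>r. r 0) Move_Right ;; Upd 0 (\<lambda>_. 0) Move_Right)
        (S' k) 3 (S' (Suc k))"
    proof (rule runs_weaken, (rule runs_Seq, rule runs_Upd[OF refl])+, rule runs_Upd[OF refl], goal_cases)
      case 1
      show ?case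
        unfolding S'_def snoc Cons
        by (cases "bs ! k")
          (simp_all add: string_tape_Cons_0 erase_string_tape written_tape_snoc[of _ True, simplified]
            written_tape_snoc[of _ False, simplified], simp_all add: load_state_def fun_eq_iff)
    qed simp
  qed (simp add: S'_def string_tape_def)
  moreover have "runs (rewind 1 ;; rewind 2 ;; rewind 3 ;; rewind 4 ;; rewind 5 ;; rewind 6) (S' (length bs))
      (4 * length bs + 8 * n + 18) (loop_state n bs [] 0 0 0 0 0 0 0 0)"
  proof (rule runs_weaken)
    let ?s = "load_state [] bs n"
    let ?u = "replicate n True"
    have "runs (rewind 1 ;; rewind 2 ;; rewind 3 ;; rewind 4 ;; rewind 5 ;; rewind 6) ?s
        ((2 * length bs + 3) + ((2 * length bs + 3) + ((2 * length ?u + 3) + ((2 * length ?u + 3) +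
          ((2 * length ?u + 3) + (2 * length ?u + 3))))))
        (?s(1 := string_tape bs, 2 := string_tape bs, 3 := string_tape ?u, 4 := string_tape ?u,
          5 := string_tape ?u, 6 := string_tape ?u))"
      by (rule runs_Seq[OF runs_rewind_written runs_Seq[OF runs_rewind_written
            runs_Seq[OF runs_rewind_written runs_Seq[OF runs_rewind_written
            runs_Seq[OF runs_rewind_written runs_rewind_written]]]]]) simp_all
    then show "runs (rewind 1 ;; rewind 2 ;; rewind 3 ;; rewind 4 ;; rewind 5 ;; rewind 6) (S' (length bs))
        ((2 * length bs + 3) + ((2 * length bs + 3) + ((2 * length ?u + 3) + ((2 * length ?u + 3) +
          ((2 * length ?u + 3) + (2 * length ?u + 3))))))
        (?s(1 := string_tape bs, 2 := string_tape bs, 3 := string_tape ?u, 4 := string_tape ?u,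
          5 := string_tape ?u, 6 := string_tape ?u))"
      by (simp add: S'_def)
    show "?s(1 := string_tape bs, 2 := string_tape bs, 3 := string_tape ?u, 4 := string_tape ?u,
        5 := string_tape ?u, 6 := string_tape ?u) = loop_state n bs [] 0 0 0 0 0 0 0 0"
      by (simp add: load_state_def loop_state_def unary_tape_def written_tape_Nil fun_eq_iff)
  qed simp
  ultimately have "runs load ?s0 (1 + (1 + (n * (5 + 1) + 1 + (1 + (length bs * (3 + 1) + 1 +
      (4 * length bs + 8 * n + 18)))))) (loop_state n bs [] 0 0 0 0 0 0 0 0)"
    unfolding load_def by - ((rule runs_Seq, assumption)+, assumption)
  then show ?thesis
    by (rule runs_mono) simp
qed

lemma length_arc_matrix: "length (arc_matrix symm n bs) = n * n * (n * n)"
  by (simp add: arc_matrix_def length_concat comp_def sum_list_triv)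

lemma runs_arc_prog:
  assumes bs: "length bs = n * n"
  shows "\<exists>s'. runs (arc_prog symm) ((\<lambda>_ _. 0)(0 := string_tape (replicate n True @ False # bs)))
      ((14 * n + 8 * (n * n) + 23) + ((n * (n * 5 + 8) + 4) + (1 +
        ((n * (n * (n * (14 * n + 18) + 22) + 13) + 4) + (2 * (n * n + 1 + n * n * (n * n)) + 3))))) s' \<and>
    s' 0 = string_tape (replicate (n * n) True @ False # arc_matrix symm n bs)"
proof -
  let ?ys = "(replicate (n * n) True @ [False]) @ arc_matrix symm n bs"
  let ?s = "loop_state n bs ?ys (n * n) 0 0 0 0 0 0 (- int n)"
  have "runs (rewind 0) ?s (2 * (n * n + 1 + n * n * (n * n)) + 3) (?s(0 := string_tape ?ys))"
    using runs_rewind_written[of ?s 0 ?ys] by (simp add: length_arc_matrix)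
  then have "runs (arc_prog symm) ((\<lambda>_ _. 0)(0 := string_tape (replicate n True @ False # bs)))
      ((14 * n + 8 * (n * n) + 23) + ((n * (n * 5 + 8) + 4) + (1 +
        ((n * (n * (n * (14 * n + 18) + 22) + 13) + 4) + (2 * (n * n + 1 + n * n * (n * n)) + 3)))))
      (?s(0 := string_tape ?ys))"
    unfolding arc_prog_def
    by (rule runs_Seq[OF runs_load[of n bs, unfolded bs] runs_Seq[OF runs_vertex_count
          runs_Seq[OF runs_write(2) runs_Seq[OF runs_arc_blocks[OF bs]]]]])
  then show ?thesis
    by (intro exI[of _ "?s(0 := string_tape ?ys)"]) simp
qed

section \<open>The arc graph on encodings, in polynomial time\<close>

definition arc_string :: "bool \<Rightarrow> bool list \<Rightarrow> bool list" where
  "arc_string symm w = (let n = length (takeWhile id w) in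
     replicate (n * n) True @ False # arc_matrix symm n (drop (Suc n) w))"

text \<open>Encodings of directed graphs are included because the second application reads the
  unsymmetrised output of the first.\<close>

definition digraph_strings :: "bool list set" where
  "digraph_strings = {encode_graph D | D n. digraph_on n D}"

lemma arc_string_encode_graph:
  assumes D: "digraph_on n D"
  shows "arc_string symm (encode_graph D) = encode_graph (arc_graph symm D)"
  unfolding encode_graph_adj_matrix[OF D] encode_graph_adj_matrix[OF digraph_on_arc_graph[OF D]]
    adj_matrix_arc_graph[OF D]
  by (simp add: arc_string_def takeWhile_append)

lemma polytime_on_arc_string: "polytime_on digraph_strings (arc_string symm)"
proof -
  define X where "X = [:0, 1 :: nat:]"
  \<comment> \<open>A transcription of the time bound of \<open>runs_arc_prog\<close> as a
    polynomial in the number of vertices.\<close>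
  define p where "p = ([:14:] * X + [:8:] * (X * X) + [:23:]) + ((X * (X * [:5:] + [:8:]) + [:4:]) + ([:1:] +
    ((X * (X * (X * ([:14:] * X + [:18:]) + [:22:]) + [:13:]) + [:4:]) +
      ([:2:] * (X * X + [:1:] + X * X * (X * X)) + [:3:]))))"
  have p: "poly p n = (14 * n + 8 * (n * n) + 23) + ((n * (n * 5 + 8) + 4) + (1 +
      ((n * (n * (n * (14 * n + 18) + 22) + 13) + 4) + (2 * (n * n + 1 + n * n * (n * n)) + 3))))" for n
    by (simp add: p_def X_def algebra_simps)
  have "tm_computes_within (prog_tm 9 (arc_prog symm)) [encode_graph D]
      (arc_string symm (encode_graph D)) (poly p (length (encode_graph D)))" if D: "digraph_on n D" for D n
  proof -
    let ?w = "replicate n True @ False # adj_matrix D"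
    obtain s' where s': "runs (arc_prog symm) ((\<lambda>_ _. 0)(0 := string_tape ?w)) (poly p n) s'"
        "s' 0 = string_tape (replicate (n * n) True @ False # arc_matrix symm n (adj_matrix D))"
      using runs_arc_prog[OF length_adj_matrix[OF D]] unfolding p by blast
    have "arc_string symm ?w = replicate (n * n) True @ False # arc_matrix symm n (adj_matrix D)"
      by (simp add: arc_string_def takeWhile_append)
    then have "tm_computes_within (prog_tm 9 (arc_prog symm)) [?w] (arc_string symm ?w) (poly p n)"
      using tm_computes_within_prog_tm[OF wf_arc_prog _ s'] by simp
    \<comment> \<open>The unary prefix makes \<open>n\<close> at most the length of the
      input.\<close>
    moreover have "poly p n \<le> poly p (length ?w)"
      by (rule poly_nat_mono) simp
    ultimately show ?thesis
      unfolding encode_graph_adj_matrix[OF D] by (rule tm_computes_within_mono)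
  qed
  then show ?thesis
    using wf_prog_tm[OF wf_arc_prog, of symm]
    unfolding polytime_on_def digraph_strings_def
    by (intro exI[of _ "prog_tm 9 (arc_prog symm)"] exI[of _ p]) auto
qed

section \<open>The reduction\<close>

lemma NP_hard_PCSP_complete_step:
  assumes hard: "NP_hard (PCSP (complete_graph (Suc m)) (complete_graph (2 ^ 2 ^ c)))" and m: "3 \<le> m"
  shows "NP_hard (PCSP (complete_graph m) (complete_graph c))"
  unfolding NP_hard_def
proof
  fix L assume "L \<in> NP"
  from hard[unfolded NP_hard_def, rule_format, OF this] obtain f where f: "polytime_computable 1 f"
      and yes: "\<And>x. x \<in> L \<Longrightarrow> f [x] \<in> fst (PCSP (complete_graph (Suc m)) (complete_graph (2 ^ 2 ^ c)))"
      and no: "\<And>x. x \<notin> L \<Longrightarrow> f [x] \<in> snd (PCSP (complete_graph (Suc m)) (complete_graph (2 ^ 2 ^ c)))"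
    by blast
  define g where "g xs = arc_string True (arc_string False (f xs))" for xs
  \<comment> \<open>A reduction to a promise problem always produces an instance satisfying the
    promise. So \<open>f [x]\<close> is a valid encoding for every \<open>x\<close>, as the
    composition with \<open>arc_string\<close> demands.\<close>
  have instance_graph: "\<exists>I n. digraph_on n I \<and> f [x] = encode_graph I \<and>
      (x \<in> L \<longrightarrow> hom_to I (complete_graph (Suc m))) \<and>
      (x \<notin> L \<longrightarrow> \<not> hom_to I (complete_graph (2 ^ 2 ^ c)))" for x
  proof (cases "x \<in> L")
    case True
    then obtain I where I: "f [x] = encode_graph I" "input_graph I" "hom_to I (complete_graph (Suc m))"
      using yes[of x] by (auto simp: PCSP_def)
    then show ?thesis
      using True digraph_on_input_graph[OF I(2)] by blast
  next
    case False
    then obtain I where I: "f [x] = encode_graph I" "input_graph I"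
        "\<not> hom_to I (complete_graph (2 ^ 2 ^ c))"
      using no[of x] by (auto simp: PCSP_def)
    then show ?thesis
      using False digraph_on_input_graph[OF I(2)] by blast
  qed
  have "f [x] \<in> digraph_strings" for x
    using instance_graph[of x] by (auto simp: digraph_strings_def)
  then have 1: "polytime_computable 1 (\<lambda>xs. arc_string False (f xs))"
    by (rule polytime_computable_compose[OF f polytime_on_arc_string])
  have "arc_string False (f [x]) \<in> digraph_strings" for x
  proof -
    obtain I n where I: "digraph_on n I" "f [x] = encode_graph I"
      using instance_graph[of x] by blast
    show ?thesis
      unfolding digraph_strings_def I(2) arc_string_encode_graph[OF I(1)]
      using digraph_on_arc_graph[OF I(1), of False] by blast
  qed
  then have "polytime_computable 1 g"
    unfolding g_def by (rule polytime_computable_compose[OF 1 polytime_on_arc_string])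
  moreover have "(x \<in> L \<longrightarrow> g [x] \<in> fst (PCSP (complete_graph m) (complete_graph c))) \<and>
      (x \<notin> L \<longrightarrow> g [x] \<in> snd (PCSP (complete_graph m) (complete_graph c)))" for x
  proof -
    obtain I n where I: "digraph_on n I" "f [x] = encode_graph I"
        "x \<in> L \<Longrightarrow> hom_to I (complete_graph (Suc m))"
        "x \<notin> L \<Longrightarrow> \<not> hom_to I (complete_graph (2 ^ 2 ^ c))"
      using instance_graph[of x] by blast
    let ?A = "arc_graph False I"
    have A: "digraph_on (n * n) ?A"
      using I(1) by (rule digraph_on_arc_graph)
    have "g [x] = encode_graph (arc_graph True ?A)"
      by (simp add: g_def I(2) arc_string_encode_graph[OF I(1)] arc_string_encode_graph[OF A])
    moreover have "input_graph (arc_graph True ?A)"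
      using A by (rule input_graph_arc_graph)
    moreover have "hom_to (arc_graph True ?A) (complete_graph m)" if "x \<in> L"
      using hom_to_complete_arc_graph_arc_graph[OF I(1) m I(3)[OF that]] .
    \<comment> \<open>A \<open>c\<close>-colouring would give \<open>?A\<close> a
      \<open>2 ^ c\<close>-colouring and \<open>I\<close> a
      \<open>2 ^ 2 ^ c\<close>-colouring.\<close>
    moreover have "\<not> hom_to (arc_graph True ?A) (complete_graph c)" if "x \<notin> L"
      using hom_to_complete_of_arc_graph[OF I(1)] hom_to_complete_of_arc_graph[OF A] I(4)[OF that] by blast
    ultimately show ?thesis
      by (auto simp: PCSP_def)
  qed
  ultimately show "\<exists>f. polytime_computable 1 f \<and>
      (\<forall>x. (x \<in> L \<longrightarrow> f [x] \<in> fst (PCSP (complete_graph m) (complete_graph c))) \<and>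
        (x \<notin> L \<longrightarrow> f [x] \<in> snd (PCSP (complete_graph m) (complete_graph c))))"
    by blast
qed

lemma hom_to_complete_graph_mono:
  assumes "hom_to I (complete_graph k)" "k \<le> m"
  shows "hom_to I (complete_graph m)"
proof -
  obtain f where "graph_hom f I (complete_graph k)"
    using assms(1) by (auto simp: hom_to_def)
  moreover have "pverts (complete_graph k) \<subseteq> pverts (complete_graph m)"
      "parcs (complete_graph k) \<subseteq> parcs (complete_graph m)"
    using assms(2) by (auto simp: complete_graph_def)
  ultimately have "graph_hom f I (complete_graph m)"
    unfolding graph_hom_def by blast
  then show ?thesis
    by (auto simp: hom_to_def)
qed

text \<open>Raising the first parameter enlarges the set of YES-instances and keeps the
  NO-instances, so the same reductions work. This settles \<open>k \<le> 3\<close>.\<close>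

lemma NP_hard_PCSP_complete_mono:
  assumes "NP_hard (PCSP (complete_graph k) G)" "k \<le> m"
  shows "NP_hard (PCSP (complete_graph m) G)"
proof -
  have "fst (PCSP (complete_graph k) G) \<subseteq> fst (PCSP (complete_graph m) G)"
    using hom_to_complete_graph_mono[OF _ assms(2)] by (auto simp: PCSP_def)
  moreover have "snd (PCSP (complete_graph k) G) = snd (PCSP (complete_graph m) G)"
    by (simp add: PCSP_def)
  ultimately show ?thesis
    using assms(1) unfolding NP_hard_def by fastforce
qed

theorem theorem1p8:
  assumes "\<exists>k::nat. \<forall>c\<ge>k. NP_hard (PCSP (complete_graph k) (complete_graph c))"
  shows "\<forall>c\<ge>3. NP_hard (PCSP (complete_graph 3) (complete_graph c))"
proof -
  let ?P = "\<lambda>k. \<forall>c\<ge>k. NP_hard (PCSP (complete_graph k) (complete_graph c))"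
  obtain k where k: "?P k"
    using assms by blast
  show ?thesis
  proof (cases "k \<le> 3")
    case True
    then show ?thesis
      using k NP_hard_PCSP_complete_mono order_trans by blast
  next
    case False
    then have "3 \<le> k"
      by simp
    then show ?thesis
      using k
    \<comment> \<open>The induction runs upward from 3 on the implication from \<open>?P k\<close>
      to the goal, so each step only has to derive \<open>?P m\<close> from
      \<open>?P (Suc m)\<close>.\<close>
    proof (induction k rule: dec_induct)
      case (step m)
      have "NP_hard (PCSP (complete_graph m) (complete_graph c))" if "m \<le> c" for c
      proof (rule NP_hard_PCSP_complete_step)
        \<comment> \<open>The hypothesis covers second parameters from \<open>Suc m\<close> on; two
          strict increases lift \<open>m \<le> c\<close> above that threshold.\<close>
        have "c < 2 ^ c" "2 ^ c < (2 :: nat) ^ 2 ^ c"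
          by (rule less_exp)+
        then have "Suc m \<le> 2 ^ 2 ^ c"
          using that by linarith
        then show "NP_hard (PCSP (complete_graph (Suc m)) (complete_graph (2 ^ 2 ^ c)))"
          using step.prems by blast
      qed fact
      then show ?case
        by (intro step.IH) blast
    qed
  qed
qed

end
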